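(* Any $\delta$-tester for pairwise uniformity (i.e. $2$-wise uniformity) of distributions on $\{-1,1\}^n$ needs at least $\Omega\!\left(\frac{n}{\delta^2}\right)$ samples.
   Context: Distributions on $\{-1,1\}^n$ are identified with densities $\varphi:\{-1,1\}^n\to\mathbb{R}^{\ge0}$ with $\mathbb{E}_{x\sim\{-1,1\}^n}[\varphi(x)]=1$, $\Pr[x]=\varphi(x)/2^n$; $\widehat\varphi(S)=\mathbb{E}_{x\sim\{-1,1\}^n}[\varphi(x)\prod_{i\in S}x_i]$. $\varphi$ is pairwise uniform iff $\widehat\varphi(S)=0$ for all $1\le|S|\le 2$. $\varphi$ is $\delta$-far from pairwise uniform if its total variation distance $\frac12\mathbb{E}_x|\varphi(x)-\psi(x)|$ to every pairwise uniform density $\psi$ exceeds $\delta$. A $\delta$-tester for pairwise uniformity receives i.i.d. samples from an unknown $\varphi$ and outputs "Yes" with high probability if $\varphi$ is pairwise uniform and "No" with high probability if $\varphi$ is $\delta$-far from pairwise uniform.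
   Formalization: The constant in Ω may depend on the success probability p > 1/2 and on a bound δ₀ < 1 with 0 < δ ≤ δ₀, and some density on {-1,1}^n must be δ-far from pairwise uniform; uniformly up to δ = 1, or with no far density, the bound fails. *)

theory Defs
  imports "HOL-Probability.Probability"
begin

(* The discrete cube {-1,1}^n.  Extensional functions on {..<n} make it a finite set with
   2^n elements, uniformly in n. *)
definition cube :: "nat \<Rightarrow> (nat \<Rightarrow> real) set" where
  "cube n = (\<Pi>\<^sub>E i\<in>{..<n}. {-1, 1})"

definition cube_mean :: "nat \<Rightarrow> ((nat \<Rightarrow> real) \<Rightarrow> real) \<Rightarrow> real" where
  "cube_mean n f = (\<Sum>x\<in>cube n. f x) / 2 ^ n"

(* Densities are taken with respect to the uniform probability measure on the cube.  Their values
   outside the cube are irrelevant to everything below. *)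
definition density_on_cube :: "nat \<Rightarrow> ((nat \<Rightarrow> real) \<Rightarrow> real) \<Rightarrow> bool" where
  "density_on_cube n \<phi> \<longleftrightarrow> (\<forall>x\<in>cube n. \<phi> x \<ge> 0) \<and> cube_mean n \<phi> = 1"

definition fourier_coeff :: "nat \<Rightarrow> ((nat \<Rightarrow> real) \<Rightarrow> real) \<Rightarrow> nat set \<Rightarrow> real" where
  "fourier_coeff n \<phi> S = cube_mean n (\<lambda>x. \<phi> x * (\<Prod>i\<in>S. x i))"

definition pairwise_uniform :: "nat \<Rightarrow> ((nat \<Rightarrow> real) \<Rightarrow> real) \<Rightarrow> bool" where
  "pairwise_uniform n \<phi> \<longleftrightarrow>
     (\<forall>S. S \<subseteq> {..<n} \<and> 1 \<le> card S \<and> card S \<le> 2 \<longrightarrow> fourier_coeff n \<phi> S = 0)"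

definition tv_dist :: "nat \<Rightarrow> ((nat \<Rightarrow> real) \<Rightarrow> real) \<Rightarrow> ((nat \<Rightarrow> real) \<Rightarrow> real) \<Rightarrow> real" where
  "tv_dist n \<phi> \<psi> = 1 / 2 * cube_mean n (\<lambda>x. \<bar>\<phi> x - \<psi> x\<bar>)"

definition far_from_pairwise_uniform :: "nat \<Rightarrow> real \<Rightarrow> ((nat \<Rightarrow> real) \<Rightarrow> real) \<Rightarrow> bool" where
  "far_from_pairwise_uniform n \<delta> \<phi> \<longleftrightarrow>
     (\<forall>\<psi>. density_on_cube n \<psi> \<and> pairwise_uniform n \<psi> \<longrightarrow> tv_dist n \<phi> \<psi> > \<delta>)"

definition cube_pmf :: "nat \<Rightarrow> ((nat \<Rightarrow> real) \<Rightarrow> real) \<Rightarrow> (nat \<Rightarrow> real) pmf" where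
  "cube_pmf n \<phi> = embed_pmf (\<lambda>x. if x \<in> cube n then \<phi> x / 2 ^ n else 0)"

(* embed_pmf is meaningful only for non-negative functions of total mass 1; densities qualify. *)
lemma finite_cube: "finite (cube n)"
  unfolding cube_def by (intro finite_PiE) auto

lemma pmf_cube_pmf:
  assumes "density_on_cube n \<phi>"
  shows "pmf (cube_pmf n \<phi>) x = (if x \<in> cube n then \<phi> x / 2 ^ n else 0)"
  unfolding cube_pmf_def
proof (rule pmf_embed_pmf)
  let ?f = "\<lambda>x. if x \<in> cube n then \<phi> x / 2 ^ n else 0"
  show nonneg: "0 \<le> ?f x" for x
    using assms by (auto simp: density_on_cube_def)
  have "(\<integral>\<^sup>+ x. ennreal (?f x) \<partial>count_space UNIV) = (\<Sum>x\<in>cube n. ennreal (?f x))"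
    by (rule nn_integral_count_space'[OF finite_cube]) auto
  also have "\<dots> = ennreal (\<Sum>x\<in>cube n. ?f x)"
    by (rule sum_ennreal) (rule nonneg)
  also have "(\<Sum>x\<in>cube n. ?f x) = cube_mean n \<phi>"
    by (simp add: cube_mean_def sum_divide_distrib)
  finally show "(\<integral>\<^sup>+ x. ennreal (?f x) \<partial>count_space UNIV) = 1"
    using assms by (simp add: density_on_cube_def)
qed

(* A possibly randomized procedure T maps the list of samples to a random verdict, True being
   "Yes".  This is the law of its verdict on m i.i.d. samples from phi. *)
definition verdict :: "nat \<Rightarrow> nat \<Rightarrow> ((nat \<Rightarrow> real) list \<Rightarrow> bool pmf) \<Rightarrow> ((nat \<Rightarrow> real) \<Rightarrow> real) \<Rightarrow> bool pmf"
  where "verdict n m T \<phi> = bind_pmf (replicate_pmf m (cube_pmf n \<phi>)) T"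

(* T is a delta-tester using m samples; "with high probability" means with probability at least p. *)
definition pairwise_uniformity_tester ::
  "real \<Rightarrow> nat \<Rightarrow> real \<Rightarrow> nat \<Rightarrow> ((nat \<Rightarrow> real) list \<Rightarrow> bool pmf) \<Rightarrow> bool" where
  "pairwise_uniformity_tester p n \<delta> m T \<longleftrightarrow>
     (\<forall>\<phi>. density_on_cube n \<phi> \<longrightarrow>
        (pairwise_uniform n \<phi> \<longrightarrow> pmf (verdict n m T \<phi>) True \<ge> p) \<and>
        (far_from_pairwise_uniform n \<delta> \<phi> \<longrightarrow> pmf (verdict n m T \<phi>) False \<ge> p))"

end

theory Submission
  imports Defs
begin

text \<open>
  For every unit vector \<open>u\<close> and every pairwise uniform \<open>\<psi>\<close> we have \<open>E\<^sub>\<psi>[\<langle>u, x\<rangle>\<^sup>2] = 1\<close>, so a density on which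
  \<open>\<langle>u, x\<rangle>\<^sup>2\<close> is bounded but has a larger mean is far from pairwise uniform. A hidden spike \<open>u\<close> ranging over
  exponentially many directions, with typical squared overlaps \<open>1/n\<close>, is invisible to \<open>o(n/\<delta>\<^sup>2)\<close> samples.

  Perturbing the uniform density would lose logarithmic factors, because \<open>\<langle>u, x\<rangle>\<^sup>2\<close> has an unbounded tail there.
  Instead the null density is a pairwise uniform \<open>\<psi>\<close> of small support: split the coordinates into blocks of
  length \<open>N = 2\<^sup>t\<close>, each an independent uniformly random signed row of a Hadamard matrix \<open>H\<close>. A sign vector
  \<open>w\<close> gives a unit vector \<open>w H / N\<close> whose inner product with the row \<open>\<epsilon> h\<^sub>i\<close> is the sign \<open>\<epsilon> w\<^sub>i\<close>.
  For \<open>k\<close> such vectors, one per block, the square of the sum of the \<open>k\<close> signs has mean \<open>k\<close> under each pairwise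
  uniform density and equals \<open>k\<^sup>2\<close> when the signs agree; so moving a \<open>\<gamma>\<close> fraction of \<open>\<psi>\<close> to the event that
  they agree costs total variation distance at least \<open>\<gamma> (1 - 1/k)\<close>. With random \<open>w\<close> the second moment of the
  likelihood ratio stays bounded as long as \<open>m \<gamma>\<^sup>2 / N\<close> is small. The constant \<open>k\<close> is chosen so that
  \<open>1 - 1/k > \<delta>\<^sub>0\<close>; for \<open>n < k\<close> one biased coordinate suffices.
\<close>

section \<open>The second moment method\<close>

lemma prod_list_map_mult:
  fixes f g :: "'a \<Rightarrow> 'b :: comm_monoid_mult"
  shows "prod_list (map (\<lambda>x. f x * g x) xs) = prod_list (map f xs) * prod_list (map g xs)"
  by (induction xs) (simp_all add: mult_ac)

lemma sum_lists_length_Suc: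
  "(\<Sum>xs\<in>{xs. set xs \<subseteq> A \<and> length xs = Suc m}. f xs) =
   (\<Sum>x\<in>A. \<Sum>xs\<in>{xs. set xs \<subseteq> A \<and> length xs = m}. f (x # xs))"
proof -
  have "(\<Sum>xs\<in>{xs. set xs \<subseteq> A \<and> length xs = Suc m}. f xs) =
        (\<Sum>(xs, x)\<in>{xs. set xs \<subseteq> A \<and> length xs = m} \<times> A. f (x # xs))"
    unfolding lists_length_Suc_eq
    by (subst sum.reindex) (auto simp: inj_on_def case_prod_unfold)
  also have "\<dots> = (\<Sum>x\<in>A. \<Sum>xs\<in>{xs. set xs \<subseteq> A \<and> length xs = m}. f (x # xs))"
    by (subst sum.cartesian_product[symmetric], subst sum.swap) simp
  finally show ?thesis .
qed

lemma sum_lists_prod_list: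
  fixes f :: "'a \<Rightarrow> 'b :: comm_semiring_1"
  shows "(\<Sum>xs\<in>{xs. set xs \<subseteq> A \<and> length xs = m}. prod_list (map f xs)) = (\<Sum>x\<in>A. f x) ^ m"
proof (induction m)
  case 0
  have "{xs. set xs \<subseteq> A \<and> length xs = 0} = {[]}" by auto
  thus ?case by simp
next
  case (Suc m)
  thus ?case
    by (simp add: sum_lists_length_Suc sum_distrib_left[symmetric] sum_distrib_right)
qed

text \<open>The cube is finite, so the law of the verdict becomes a finite weighted sum and the
  second moment argument needs no integrals.\<close>

lemma pmf_verdict:
  assumes "density_on_cube n \<phi>"
  shows "pmf (verdict n m T \<phi>) b =
    (\<Sum>xs\<in>{xs. set xs \<subseteq> cube n \<and> length xs = m}.
       prod_list (map (\<lambda>x. \<phi> x / 2 ^ n) xs) * pmf (T xs) b)"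
  unfolding verdict_def
proof (induction m arbitrary: T)
  case 0
  have "{xs. set xs \<subseteq> cube n \<and> length xs = 0} = {[]}" by auto
  thus ?case by (simp add: bind_return_pmf)
next
  case (Suc m)
  have "pmf (replicate_pmf (Suc m) (cube_pmf n \<phi>) \<bind> T) b =
        (LINT x|measure_pmf (cube_pmf n \<phi>).
           pmf (replicate_pmf m (cube_pmf n \<phi>) \<bind> (\<lambda>xs. T (x # xs))) b)"
    by (simp add: bind_assoc_pmf bind_return_pmf pmf_bind[of "cube_pmf n \<phi>"])
  also have "\<dots> = (\<Sum>x\<in>cube n. \<phi> x / 2 ^ n *
           pmf (replicate_pmf m (cube_pmf n \<phi>) \<bind> (\<lambda>xs. T (x # xs))) b)"
    using assms
    by (subst integral_measure_pmf[OF finite_cube[of n]])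
       (auto simp: set_pmf_eq pmf_cube_pmf split: if_splits)
  also have "\<dots> = (\<Sum>xs\<in>{xs. set xs \<subseteq> cube n \<and> length xs = Suc m}.
       prod_list (map (\<lambda>x. \<phi> x / 2 ^ n) xs) * pmf (T xs) b)"
    by (simp add: Suc.IH sum_lists_length_Suc sum_distrib_left mult.assoc)
  finally show ?case .
qed

text \<open>The tester separates \<open>\<psi>\<close> from the uniform mixture of the densities
  \<open>\<psi> x * r w x\<close>. By Cauchy-Schwarz its advantage is at most the standard deviation
  of the likelihood ratio of the mixture; independence of the samples turns each cross term of the
  second moment into an \<open>m\<close>-th power.\<close>

lemma second_moment_method:
  fixes W :: "'w set" and p :: real
  assumes \<psi>: "density_on_cube n \<psi>" "pairwise_uniform n \<psi>"
    and W: "finite W"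
    and \<phi>: "\<And>w. w \<in> W \<Longrightarrow> density_on_cube n (\<lambda>x. \<psi> x * r w x)"
    and far: "\<And>w. w \<in> W \<Longrightarrow> far_from_pairwise_uniform n \<delta> (\<lambda>x. \<psi> x * r w x)"
    and T: "pairwise_uniformity_tester p n \<delta> m T" and p: "1 / 2 < p"
  shows "(real (card W))\<^sup>2 * (1 + (2 * p - 1)\<^sup>2) \<le>
    (\<Sum>w\<in>W. \<Sum>v\<in>W. cube_mean n (\<lambda>x. \<psi> x * r w x * r v x) ^ m)"
proof -
  define X where "X = {xs. set xs \<subseteq> cube n \<and> length xs = m}"
  define P where "P xs = prod_list (map (\<lambda>x. \<psi> x / 2 ^ n) xs)" for xs
  define R where "R w xs = prod_list (map (r w) xs)" for w xs
  define F where "F xs = pmf (T xs) False" for xs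
  \<comment> \<open>Up to normalisation by \<open>c\<close>, this is the likelihood ratio of the
    mixture on \<open>m\<close> samples.\<close>
  define L where "L xs = (\<Sum>w\<in>W. R w xs)" for xs
  define c where "c = real (card W)"
  have mean: "(\<Sum>xs\<in>X. P xs * prod_list (map g xs)) = cube_mean n (\<lambda>x. \<psi> x * g x) ^ m" for g
  proof -
    have "(\<Sum>xs\<in>X. P xs * prod_list (map g xs)) =
          (\<Sum>xs\<in>X. prod_list (map (\<lambda>x. \<psi> x / 2 ^ n * g x) xs))"
      unfolding P_def by (simp only: prod_list_map_mult)
    thus ?thesis
      unfolding X_def cube_mean_def by (simp add: sum_lists_prod_list sum_divide_distrib)
  qed
  have P0: "P xs \<ge> 0" if "xs \<in> X" for xs
  proof -
    have "\<psi> x \<ge> 0" if "x \<in> set xs" for x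
      using that \<open>xs \<in> X\<close> \<psi>(1) by (auto simp: density_on_cube_def X_def)
    thus ?thesis unfolding P_def by (auto intro!: prod_list_nonneg)
  qed
  have P1: "(\<Sum>xs\<in>X. P xs) = 1"
    using mean[of "\<lambda>_. 1"] \<psi> by (simp add: density_on_cube_def map_replicate_const prod_list_replicate)
  have PR: "(\<Sum>xs\<in>X. P xs * R w xs) = 1" if "w \<in> W" for w
    using mean[of "r w"] \<phi>[OF that] unfolding R_def by (simp add: density_on_cube_def)
  have yes: "(\<Sum>xs\<in>X. P xs * F xs) \<le> 1 - p"
  proof -
    have "p \<le> pmf (verdict n m T \<psi>) True"
      using T \<psi> by (auto simp: pairwise_uniformity_tester_def)
    moreover have "pmf (verdict n m T \<psi>) False = (\<Sum>xs\<in>X. P xs * F xs)"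
      unfolding pmf_verdict[OF \<psi>(1)] P_def X_def F_def ..
    ultimately show ?thesis by (simp add: pmf_False_conv_True)
  qed
  have no: "p \<le> (\<Sum>xs\<in>X. P xs * R w xs * F xs)" if "w \<in> W" for w
  proof -
    have "p \<le> pmf (verdict n m T (\<lambda>x. \<psi> x * r w x)) False"
      using T \<phi>[OF that] far[OF that] by (auto simp: pairwise_uniformity_tester_def)
    also have "\<dots> = (\<Sum>xs\<in>X. P xs * R w xs * F xs)"
      unfolding pmf_verdict[OF \<phi>[OF that]] P_def X_def F_def R_def
      by (simp only: prod_list_map_mult[symmetric] times_divide_eq_left)
    finally show ?thesis .
  qed
  have "c * (2 * p - 1) = (\<Sum>w\<in>W. p) - c * (1 - p)"
    by (simp add: c_def algebra_simps)
  also have "\<dots> \<le> (\<Sum>w\<in>W. \<Sum>xs\<in>X. P xs * R w xs * F xs) - c * (\<Sum>xs\<in>X. P xs * F xs)"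
    by (intro diff_mono sum_mono mult_left_mono no yes) (simp_all add: c_def)
  \<comment> \<open>The weight \<open>P xs\<close> is split into two square roots so that
    Cauchy-Schwarz applies with respect to \<open>P\<close>.\<close>
  also have "\<dots> = (\<Sum>xs\<in>X. (sqrt (P xs) * (L xs - c)) * (sqrt (P xs) * F xs))"
  proof -
    have "(\<Sum>w\<in>W. \<Sum>xs\<in>X. P xs * R w xs * F xs) = (\<Sum>xs\<in>X. P xs * L xs * F xs)"
      unfolding L_def by (subst sum.swap) (simp add: sum_distrib_left sum_distrib_right)
    moreover have "(\<Sum>xs\<in>X. (sqrt (P xs) * (L xs - c)) * (sqrt (P xs) * F xs)) =
        (\<Sum>xs\<in>X. P xs * L xs * F xs - c * (P xs * F xs))"
    proof (rule sum.cong[OF refl])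
      fix xs assume "xs \<in> X"
      have "(sqrt (P xs) * (L xs - c)) * (sqrt (P xs) * F xs) =
            (sqrt (P xs))\<^sup>2 * ((L xs - c) * F xs)"
        by (simp add: power2_eq_square)
      thus "(sqrt (P xs) * (L xs - c)) * (sqrt (P xs) * F xs) =
            P xs * L xs * F xs - c * (P xs * F xs)"
        using P0[OF \<open>xs \<in> X\<close>] by (simp add: algebra_simps)
    qed
    ultimately show ?thesis by (simp add: sum_subtractf sum_distrib_left)
  qed
  finally have adv: "c * (2 * p - 1) \<le> \<dots>" .
  have "(c * (2 * p - 1))\<^sup>2 \<le> (\<Sum>xs\<in>X. (sqrt (P xs) * (L xs - c)) * (sqrt (P xs) * F xs))\<^sup>2"
    using p by (intro power_mono adv) (simp add: c_def)
  also have "\<dots> \<le> (\<Sum>xs\<in>X. (sqrt (P xs) * (L xs - c))\<^sup>2) * (\<Sum>xs\<in>X. (sqrt (P xs) * F xs)\<^sup>2)"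
    by (rule Cauchy_Schwarz_ineq_sum)
  also have "\<dots> \<le> (\<Sum>xs\<in>X. (sqrt (P xs) * (L xs - c))\<^sup>2) * 1"
  proof (intro mult_left_mono sum_nonneg)
    have "(\<Sum>xs\<in>X. (sqrt (P xs) * F xs)\<^sup>2) \<le> (\<Sum>xs\<in>X. P xs)"
    proof (rule sum_mono)
      fix xs assume "xs \<in> X"
      moreover have "(F xs)\<^sup>2 \<le> 1" unfolding F_def by (simp add: power_le_one pmf_le_1)
      ultimately show "(sqrt (P xs) * F xs)\<^sup>2 \<le> P xs"
        using P0[of xs] by (simp add: power_mult_distrib mult_left_le)
    qed
    thus "(\<Sum>xs\<in>X. (sqrt (P xs) * F xs)\<^sup>2) \<le> 1" by (simp add: P1)
  qed simp
  \<comment> \<open>Variance of \<open>L\<close>: its mean under \<open>P\<close> is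
    \<open>c\<close>, so the square of \<open>c\<close> moves to the left and accounts for the
    summand 1 in the claim.\<close>
  also have "\<dots> = (\<Sum>xs\<in>X. P xs * (L xs)\<^sup>2 - 2 * c * (P xs * L xs) + c\<^sup>2 * P xs)"
    using P0 by (auto simp: power_mult_distrib power2_diff algebra_simps intro!: sum.cong)
  also have "\<dots> = (\<Sum>xs\<in>X. P xs * (L xs)\<^sup>2) - 2 * c * (\<Sum>xs\<in>X. P xs * L xs) + c\<^sup>2"
    by (simp add: sum.distrib sum_subtractf sum_distrib_left[symmetric] P1)
  also have "(\<Sum>xs\<in>X. P xs * L xs) = (\<Sum>w\<in>W. \<Sum>xs\<in>X. P xs * R w xs)"
    unfolding L_def by (subst sum.swap) (simp add: sum_distrib_left)
  also have "\<dots> = c" by (simp add: PR c_def)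
  also have "(\<Sum>xs\<in>X. P xs * (L xs)\<^sup>2) = (\<Sum>xs\<in>X. \<Sum>w\<in>W. \<Sum>v\<in>W. P xs * R w xs * R v xs)"
    unfolding L_def power2_eq_square sum_product by (simp add: sum_distrib_left mult.assoc)
  also have "\<dots> = (\<Sum>w\<in>W. \<Sum>v\<in>W. \<Sum>xs\<in>X. P xs * R w xs * R v xs)"
    by (subst sum.swap, rule sum.cong[OF refl], rule sum.swap)
  also have "\<dots> = (\<Sum>w\<in>W. \<Sum>v\<in>W. cube_mean n (\<lambda>x. \<psi> x * r w x * r v x) ^ m)"
  proof (intro sum.cong refl)
    fix w v
    show "(\<Sum>xs\<in>X. P xs * R w xs * R v xs) = cube_mean n (\<lambda>x. \<psi> x * r w x * r v x) ^ m"
      using mean[of "\<lambda>x. r w x * r v x"] by (simp add: R_def prod_list_map_mult mult.assoc)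
  qed
  finally show ?thesis by (simp add: c_def power_mult_distrib power2_eq_square algebra_simps)
qed

section \<open>Distance to pairwise uniformity\<close>

lemma cubeD: "x \<in> cube n \<Longrightarrow> j < n \<Longrightarrow> x j = 1 \<or> x j = -1"
  by (auto simp: cube_def PiE_iff)

lemma square_cube [simp]: "x \<in> cube n \<Longrightarrow> j < n \<Longrightarrow> x j * x j = 1"
  using cubeD[of x n j] by auto

lemma cube_mean_cong: "(\<And>x. x \<in> cube n \<Longrightarrow> f x = g x) \<Longrightarrow> cube_mean n f = cube_mean n g"
  by (simp add: cube_mean_def)

lemma cube_mean_mono: "(\<And>x. x \<in> cube n \<Longrightarrow> f x \<le> g x) \<Longrightarrow> cube_mean n f \<le> cube_mean n g"
  by (auto simp: cube_mean_def intro!: divide_right_mono sum_mono)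

lemma cube_mean_add: "cube_mean n (\<lambda>x. f x + g x) = cube_mean n f + cube_mean n g"
  by (simp add: cube_mean_def sum.distrib add_divide_distrib)

lemma cube_mean_diff: "cube_mean n (\<lambda>x. f x - g x) = cube_mean n f - cube_mean n g"
  by (simp add: cube_mean_def sum_subtractf diff_divide_distrib)

lemma cube_mean_cmult: "cube_mean n (\<lambda>x. c * f x) = c * cube_mean n f"
  by (simp add: cube_mean_def sum_distrib_left)

lemma cube_mean_sum: "cube_mean n (\<lambda>x. \<Sum>j\<in>J. f j x) = (\<Sum>j\<in>J. cube_mean n (f j))"
  unfolding cube_mean_def by (subst sum.swap) (simp add: sum_divide_distrib)

lemma pairwise_uniform_iff:
  "pairwise_uniform n \<psi> \<longleftrightarrow>
     (\<forall>i<n. cube_mean n (\<lambda>x. \<psi> x * x i) = 0) \<and>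
     (\<forall>i<n. \<forall>j<n. i \<noteq> j \<longrightarrow> cube_mean n (\<lambda>x. \<psi> x * (x i * x j)) = 0)"
  (is "_ \<longleftrightarrow> ?R")
proof
  assume \<psi>: "pairwise_uniform n \<psi>"
  show ?R
  proof (intro conjI allI impI)
    fix i assume "i < n"
    thus "cube_mean n (\<lambda>x. \<psi> x * x i) = 0"
      using \<psi>[unfolded pairwise_uniform_def fourier_coeff_def, rule_format, of "{i}"] by simp
  next
    fix i j assume "i < n" "j < n" "i \<noteq> j"
    thus "cube_mean n (\<lambda>x. \<psi> x * (x i * x j)) = 0"
      using \<psi>[unfolded pairwise_uniform_def fourier_coeff_def, rule_format, of "{i, j}"] by simp
  qed
next
  assume R: ?R
  show "pairwise_uniform n \<psi>"
    unfolding pairwise_uniform_def fourier_coeff_def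
  proof (intro allI impI, elim conjE)
    fix S assume S: "S \<subseteq> {..<n}" "1 \<le> card S" "card S \<le> 2"
    then consider "card S = 1" | "card S = 2" by linarith
    thus "cube_mean n (\<lambda>x. \<psi> x * (\<Prod>i\<in>S. x i)) = 0"
    proof cases
      case 1
      then obtain i where "S = {i}" by (auto simp: card_1_singleton_iff)
      thus ?thesis using R S by simp
    next
      case 2
      then obtain i j where "S = {i, j}" "i \<noteq> j" by (auto simp: card_2_iff)
      thus ?thesis using R S by simp
    qed
  qed
qed

text \<open>The constant 1 and the coordinates are orthonormal under a pairwise uniform density, so
  this is Parseval's identity for affine forms.\<close>

lemma mean_affine_square:
  assumes "density_on_cube n \<psi>" "pairwise_uniform n \<psi>"
  shows "cube_mean n (\<lambda>x. \<psi> x * (c\<^sub>0 + (\<Sum>j<n. c j * x j))\<^sup>2) = c\<^sub>0\<^sup>2 + (\<Sum>j<n. (c j)\<^sup>2)"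
proof -
  have cov: "cube_mean n (\<lambda>x. \<psi> x * (x i * x j)) = (if i = j then 1 else 0)"
    if "i < n" "j < n" for i j
  proof (cases "i = j")
    case True
    have "cube_mean n (\<lambda>x. \<psi> x * (x i * x j)) = cube_mean n \<psi>"
      by (rule cube_mean_cong) (use that True in simp)
    thus ?thesis using assms True by (simp add: density_on_cube_def)
  qed (use assms that in \<open>simp add: pairwise_uniform_iff\<close>)
  have "cube_mean n (\<lambda>x. \<psi> x * (c\<^sub>0 + (\<Sum>j<n. c j * x j))\<^sup>2) =
        cube_mean n (\<lambda>x. c\<^sub>0\<^sup>2 * \<psi> x + (\<Sum>j<n. (2 * c\<^sub>0 * c j) * (\<psi> x * x j)) +
          (\<Sum>i<n. \<Sum>j<n. (c i * c j) * (\<psi> x * (x i * x j))))"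
    by (rule cube_mean_cong)
       (simp add: power2_sum, simp add: power2_eq_square sum_product sum_distrib_left algebra_simps)
  also have "\<dots> = c\<^sub>0\<^sup>2 + (\<Sum>j<n. (2 * c\<^sub>0 * c j) * 0) +
          (\<Sum>i<n. \<Sum>j<n. (c i * c j) * (if i = j then 1 else 0))"
    unfolding cube_mean_add cube_mean_sum cube_mean_cmult
    using assms by (auto simp: cov pairwise_uniform_iff density_on_cube_def
        intro!: arg_cong2[where f = "(+)"] sum.cong)
  also have "\<dots> = c\<^sub>0\<^sup>2 + (\<Sum>j<n. (c j)\<^sup>2)"
    by (simp add: power2_eq_square if_distrib cong: if_cong)
  finally show ?thesis .
qed

text \<open>
  The test function is \<open>min 1 q\<close> for the square \<open>q\<close> of an affine form: its mean does not exceed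
  that of \<open>q\<close>, which is the same for all pairwise uniform densities.
\<close>

lemma far_from_pairwise_uniformI:
  assumes \<phi>: "density_on_cube n \<phi>"
    and supp: "\<And>x. x \<in> cube n \<Longrightarrow> \<phi> x \<noteq> 0 \<Longrightarrow> (c\<^sub>0 + (\<Sum>j<n. c j * x j))\<^sup>2 \<le> 1"
    and gap: "\<delta> + (c\<^sub>0\<^sup>2 + (\<Sum>j<n. (c j)\<^sup>2)) <
      cube_mean n (\<lambda>x. \<phi> x * (c\<^sub>0 + (\<Sum>j<n. c j * x j))\<^sup>2)"
  shows "far_from_pairwise_uniform n \<delta> \<phi>"
  unfolding far_from_pairwise_uniform_def
proof (intro allI impI, elim conjE)
  fix \<psi> assume \<psi>: "density_on_cube n \<psi>" "pairwise_uniform n \<psi>"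
  define q where "q x = (c\<^sub>0 + (\<Sum>j<n. c j * x j))\<^sup>2" for x
  define f where "f x = min 1 (q x)" for x
  have "\<delta> < cube_mean n (\<lambda>x. \<phi> x * q x) - cube_mean n (\<lambda>x. \<psi> x * q x)"
    using gap unfolding q_def mean_affine_square[OF \<psi>] by simp
  also have "cube_mean n (\<lambda>x. \<phi> x * q x) = cube_mean n (\<lambda>x. \<phi> x * f x)"
  proof (rule cube_mean_cong)
    fix x assume "x \<in> cube n"
    from supp[OF this] show "\<phi> x * q x = \<phi> x * f x"
      by (cases "\<phi> x = 0") (auto simp: f_def q_def)
  qed
  also have "cube_mean n (\<lambda>x. \<phi> x * f x) - cube_mean n (\<lambda>x. \<psi> x * q x) \<le>
      cube_mean n (\<lambda>x. \<phi> x * f x) - cube_mean n (\<lambda>x. \<psi> x * f x)"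
    using \<psi>(1) by (intro diff_left_mono cube_mean_mono mult_left_mono)
                   (auto simp: f_def density_on_cube_def)
  \<comment> \<open>The subtracted term has mean zero. It centres \<open>f\<close> at 1/2, and the
    distance of \<open>f\<close> from 1/2 being at most 1/2 supplies the factor 1/2 of the total
    variation distance.\<close>
  also have "\<dots> = cube_mean n (\<lambda>x. \<phi> x * f x - \<psi> x * f x - 1 / 2 * (\<phi> x - \<psi> x))"
    using \<phi> \<psi>(1) unfolding cube_mean_diff cube_mean_cmult by (simp add: density_on_cube_def)
  also have "\<dots> \<le> cube_mean n (\<lambda>x. 1 / 2 * \<bar>\<phi> x - \<psi> x\<bar>)"
  proof (rule cube_mean_mono)
    fix x
    have "\<bar>f x - 1 / 2\<bar> \<le> 1 / 2" by (auto simp: f_def q_def abs_if min_def)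
    hence "\<bar>\<phi> x - \<psi> x\<bar> * \<bar>f x - 1 / 2\<bar> \<le> \<bar>\<phi> x - \<psi> x\<bar> * (1 / 2)"
      by (rule mult_left_mono) simp
    hence "(\<phi> x - \<psi> x) * (f x - 1 / 2) \<le> 1 / 2 * \<bar>\<phi> x - \<psi> x\<bar>"
      unfolding abs_mult[symmetric] by linarith
    thus "\<phi> x * f x - \<psi> x * f x - 1 / 2 * (\<phi> x - \<psi> x) \<le> 1 / 2 * \<bar>\<phi> x - \<psi> x\<bar>"
      by (simp add: algebra_simps)
  qed
  also have "\<dots> = tv_dist n \<phi> \<psi>"
    by (simp only: tv_dist_def cube_mean_cmult)
  finally show "tv_dist n \<phi> \<psi> > \<delta>" .
qed

section \<open>The uniform density and a single biased coordinate\<close>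

lemma card_cube: "card (cube n) = 2 ^ n"
  by (simp add: cube_def card_PiE numeral_2_eq_2)

lemma density_uniform: "density_on_cube n (\<lambda>_. 1)"
  by (simp add: density_on_cube_def cube_mean_def card_cube)

text \<open>The sum factors over the coordinates, and each coordinate in \<open>S\<close>
  contributes -1 + 1 = 0.\<close>

lemma sum_cube_prod:
  assumes "S \<subseteq> {..<n}" "S \<noteq> {}"
  shows "(\<Sum>x\<in>cube n. \<Prod>i\<in>S. x i) = 0"
proof -
  have "(\<Sum>x\<in>cube n. \<Prod>i\<in>S. x i) = (\<Sum>x\<in>cube n. \<Prod>i<n. if i \<in> S then x i else 1)"
    using assms by (intro sum.cong refl, subst prod.inter_restrict[symmetric])
                   (simp_all add: Int_absorb1)
  also have "\<dots> = (\<Prod>i<n. \<Sum>y\<in>{-1, 1}. if i \<in> S then y else 1)"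
    unfolding cube_def by (subst prod_sum_PiE) auto
  also have "\<dots> = 0"
    using assms by auto
  finally show ?thesis .
qed

lemma pairwise_uniform_uniform: "pairwise_uniform n (\<lambda>_. 1)"
  unfolding pairwise_uniform_def fourier_coeff_def cube_mean_def
proof (intro allI impI, elim conjE)
  fix S assume "S \<subseteq> {..<n}" "1 \<le> card S"
  thus "(\<Sum>x\<in>cube n. 1 * (\<Prod>i\<in>S. x i)) / 2 ^ n = 0"
    by (cases "S = {}") (simp_all add: sum_cube_prod)
qed

text \<open>With \<open>m = 0\<close> the second moment is an empty power, equal to 1, which leaves
  no room for an advantage. This settles the case of large \<open>\<delta>\<close> in small
  dimension.\<close>

lemma one_sample_needed:
  assumes "density_on_cube n \<phi>" "far_from_pairwise_uniform n \<delta> \<phi>"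
    and "pairwise_uniformity_tester p n \<delta> m T" "1 / 2 < p"
  shows "m > 0"
proof (rule ccontr)
  assume "\<not> m > 0"
  hence "1 + (2 * p - 1)\<^sup>2 \<le> 1"
    using second_moment_method[OF density_uniform[of n] pairwise_uniform_uniform, where W = "{()}" and r = "\<lambda>_. \<phi>"
      and \<delta> = \<delta> and p = p and m = m and T = T] assms
    by auto
  thus False using assms(4) by simp
qed

text \<open>Serves dimensions too small for the block construction. The bias
  \<open>4 * \<delta>\<close> raises the probability of \<open>x 0 = 1\<close> from 1/2 to
  \<open>1 / 2 + 2 * \<delta>\<close>, and \<open>\<delta> \<le> 1 / 4\<close> keeps the density
  non-negative.\<close>

lemma biased_coordinate_bound:
  assumes n: "0 < n" and \<delta>: "0 < \<delta>" "\<delta> \<le> 1 / 4"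
    and T: "pairwise_uniformity_tester p n \<delta> m T" and p: "1 / 2 < p"
  shows "1 + (2 * p - 1)\<^sup>2 \<le> exp (16 * m * \<delta>\<^sup>2)"
proof -
  let ?r = "\<lambda>x :: nat \<Rightarrow> real. 1 + 4 * \<delta> * x 0"
  \<comment> \<open>With the constant term 1/2 this affine form is the indicator of
    \<open>x 0 = 1\<close>, hence equal to its own square on the cube.\<close>
  define c :: "nat \<Rightarrow> real" where "c j = (if j = 0 then 1 / 2 else 0)" for j
  have E0: "cube_mean n (\<lambda>x. x 0) = 0" and E1: "cube_mean n (\<lambda>_. 1) = 1"
    using pairwise_uniform_uniform[of n] density_uniform[of n] n
    by (auto simp: pairwise_uniform_iff density_on_cube_def)
  have mean: "cube_mean n (\<lambda>x. a + b * x 0) = a" for a b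
    using cube_mean_cmult[of n a "\<lambda>_. 1"] by (simp add: cube_mean_add cube_mean_cmult E0 E1)
  have pos: "?r x \<ge> 0" if "x \<in> cube n" for x
    using cubeD[OF that n] \<delta> by auto
  have dens: "density_on_cube n ?r"
    using pos mean[of 1 "4 * \<delta>"] by (simp add: density_on_cube_def)
  have c: "(\<Sum>j<n. c j * x j) = x 0 / 2" for x :: "nat \<Rightarrow> real"
    using n by (simp add: c_def if_distrib[of "\<lambda>y. y * _"] cong: if_cong)
  have "(\<Sum>j<n. (c j)\<^sup>2) = (\<Sum>j<n. if j = 0 then 1 / 4 else 0)"
    by (rule sum.cong) (auto simp: c_def power2_eq_square)
  hence c_sq: "(\<Sum>j<n. (c j)\<^sup>2) = 1 / 4" using n by simp
  have far: "far_from_pairwise_uniform n \<delta> ?r"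
  proof (rule far_from_pairwise_uniformI[OF dens, where c\<^sub>0 = "1 / 2" and c = c])
    fix x assume "x \<in> cube n"
    from cubeD[OF this n] show "(1 / 2 + (\<Sum>j<n. c j * x j))\<^sup>2 \<le> 1" by (auto simp: c)
  next
    have "cube_mean n (\<lambda>x. ?r x * (1 / 2 + (\<Sum>j<n. c j * x j))\<^sup>2) =
          cube_mean n (\<lambda>x. (1 / 2 + 2 * \<delta>) + (1 / 2 + 2 * \<delta>) * x 0)"
    proof (rule cube_mean_cong)
      fix x assume "x \<in> cube n"
      from cubeD[OF this n]
      show "?r x * (1 / 2 + (\<Sum>j<n. c j * x j))\<^sup>2 = (1 / 2 + 2 * \<delta>) + (1 / 2 + 2 * \<delta>) * x 0"
        by (auto simp: c)
    qed
    also have "\<dots> = 1 / 2 + 2 * \<delta>" by (rule mean)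
    finally show "\<delta> + ((1 / 2)\<^sup>2 + (\<Sum>j<n. (c j)\<^sup>2)) <
        cube_mean n (\<lambda>x. ?r x * (1 / 2 + (\<Sum>j<n. c j * x j))\<^sup>2)"
      using \<delta> by (simp add: c_sq power2_eq_square[of "1 / 2"])
  qed
  have "cube_mean n (\<lambda>x. ?r x * ?r x) = cube_mean n (\<lambda>x. (1 + 16 * \<delta>\<^sup>2) + (8 * \<delta>) * x 0)"
  proof (rule cube_mean_cong)
    fix x assume "x \<in> cube n"
    from cubeD[OF this n] show "?r x * ?r x = (1 + 16 * \<delta>\<^sup>2) + (8 * \<delta>) * x 0"
      by (auto simp: power2_eq_square algebra_simps)
  qed
  also have "\<dots> = 1 + 16 * \<delta>\<^sup>2" by (rule mean)
  finally have "1 + (2 * p - 1)\<^sup>2 \<le> (1 + 16 * \<delta>\<^sup>2) ^ m"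
    using second_moment_method[OF density_uniform[of n] pairwise_uniform_uniform, where W = "{()}" and r = "\<lambda>_. ?r"
      and \<delta> = \<delta> and p = p and m = m and T = T]
      T p dens far by auto
  also have "\<dots> \<le> exp (16 * \<delta>\<^sup>2) ^ m"
    by (intro power_mono exp_ge_add_one_self) simp
  also have "\<dots> = exp (16 * m * \<delta>\<^sup>2)"
    by (simp add: exp_of_nat_mult[symmetric] mult_ac)
  finally show ?thesis .
qed

section \<open>Hadamard matrices and sign sums\<close>

text \<open>Hoeffding's lemma for a fair coin on an interval of length \<open>2 * y\<close>;
  negative \<open>y\<close> follows by evenness.\<close>

lemma cosh_le_exp_square: "cosh y \<le> exp (y\<^sup>2 / 2)" for y :: real
proof -
  have "cosh y \<le> exp (y\<^sup>2 / 2)" if "y \<ge> 0" for y :: real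
  proof -
    have "1 + 1 / 2 * (exp (2 * y) - 1) = exp y * cosh y"
      by (simp add: cosh_field_def field_simps flip: exp_add)
    hence "ln (1 + 1 / 2 * (exp (2 * y) - 1)) = y + ln (cosh y)"
      by (simp add: ln_mult)
    moreover have "- (2 * y) * (1 / 2) + ln (1 + 1 / 2 * (exp (2 * y) - 1)) \<le> (2 * y)\<^sup>2 / 8"
      by (rule Hoeffdings_lemma_aux) (use that in auto)
    ultimately have "ln (cosh y) \<le> y\<^sup>2 / 2"
      by (simp add: power2_eq_square)
    thus ?thesis
      by (metis cosh_real_pos exp_le_cancel_iff exp_ln)
  qed
  from this[of "\<bar>y\<bar>"] show ?thesis by simp
qed

text \<open>Sylvester's matrix: the sign is the parity of the number of positions among the lowest
  \<open>t\<close> binary digits where \<open>i\<close> and \<open>a\<close> both have a 1.\<close>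

primrec hadamard :: "nat \<Rightarrow> nat \<Rightarrow> nat \<Rightarrow> real" where
  "hadamard 0 i a = 1"
| "hadamard (Suc t) i a = hadamard t (i div 2) (a div 2) * (if odd i \<and> odd a then -1 else 1)"

lemma hadamard_commute: "hadamard t i a = hadamard t a i"
  by (induction t arbitrary: i a) auto

lemma hadamard_sign: "hadamard t i a = 1 \<or> hadamard t i a = -1"
proof (induction t arbitrary: i a)
  case (Suc t)
  from Suc[of "i div 2" "a div 2"] show ?case by auto
qed simp

lemma sum_lessThan_double:
  fixes f :: "nat \<Rightarrow> 'a :: comm_monoid_add"
  shows "(\<Sum>a<2 * M. f a) = (\<Sum>b<M. f (2 * b) + f (2 * b + 1))"
  by (induction M) (simp_all add: add_ac)

text \<open>Grouping the columns \<open>2 * b\<close> and \<open>2 * b + 1\<close> leaves a factor 1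
  plus the product of the two parity signs. Distinct rows differ in the lowest bit, where this
  factor vanishes, or in the remaining bits, where the induction hypothesis gives 0.\<close>

lemma hadamard_orthogonal:
  assumes "i < 2 ^ t" "j < 2 ^ t"
  shows "(\<Sum>a<2 ^ t. hadamard t i a * hadamard t j a) = (if i = j then 2 ^ t else 0)"
  using assms
proof (induction t arbitrary: i j)
  case (Suc t)
  let ?s = "\<lambda>i :: nat. if odd i then -1 else 1 :: real"
  have ij: "i div 2 < 2 ^ t" "j div 2 < 2 ^ t" using Suc.prems by auto
  have "(\<Sum>a<2 ^ Suc t. hadamard (Suc t) i a * hadamard (Suc t) j a) =
        (\<Sum>b<2 ^ t. hadamard t (i div 2) b * hadamard t (j div 2) b * (1 + ?s i * ?s j))"
    by (simp only: power_Suc sum_lessThan_double) (rule sum.cong, auto)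
  also have "\<dots> = (if i div 2 = j div 2 then 2 ^ t else 0) * (1 + ?s i * ?s j)"
    by (simp only: sum_distrib_right[symmetric] Suc.IH[OF ij])
  also have "\<dots> = (if i = j then 2 ^ Suc t else 0)"
  proof (cases "i = j")
    case False
    hence "i div 2 \<noteq> j div 2 \<or> odd i \<noteq> odd j"
      by (metis even_two_times_div_two odd_two_times_div_two_succ)
    thus ?thesis using False by auto
  qed auto
  finally show ?case .
qed simp

section \<open>Exponential moments of squared sign sums\<close>

lemma sum_cube_Suc:
  "(\<Sum>w\<in>cube (Suc N). f w) = (\<Sum>w\<in>cube N. f (w(N := -1)) + f (w(N := 1)))"
proof -
  have "(\<Sum>w\<in>cube (Suc N). f w) = (\<Sum>(y, w)\<in>{-1, 1} \<times> cube N. f (w(N := y)))"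
    unfolding cube_def lessThan_Suc PiE_insert_eq
    by (subst sum.reindex[OF inj_combinator]) (auto simp: case_prod_unfold)
  also have "\<dots> = (\<Sum>w\<in>cube N. f (w(N := -1)) + f (w(N := 1)))"
    by (subst sum.cartesian_product[symmetric]) (simp add: sum.distrib)
  finally show ?thesis .
qed

text \<open>
  Averaging over one sign turns the exponent \<open>s\<close> into at most \<open>s (1 + 2 s)\<close> since \<open>cosh y \<le> exp (y\<^sup>2 / 2)\<close>;
  the bound is the one for which \<open>1 / s\<close> drops by at most 2 in each step.
\<close>

lemma sum_cube_exp_square:
  assumes "\<And>i. i < N \<Longrightarrow> v i = 1 \<or> v i = -1" and "0 \<le> s" and "2 * real N * s < 1"
  shows "(\<Sum>w\<in>cube N. exp (s * (\<Sum>i<N. w i * v i)\<^sup>2)) \<le> 2 ^ N * exp (real N * s / (1 - 2 * real N * s))"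
  using assms
proof (induction N arbitrary: s)
  case 0
  show ?case by (simp add: card_cube)
next
  case (Suc N)
  define s' where "s' = s * (1 + 2 * s)"
  define D where "D = 1 - 2 * real (Suc N) * s"
  have s: "s \<ge> 0" and D: "D > 0" using Suc.prems by (auto simp: D_def)
  have "2 * real N * s' = (1 - D - 2 * s) * (1 + 2 * s)"
    by (simp add: s'_def D_def algebra_simps)
  also have "\<dots> = 1 - 4 * s\<^sup>2 - D * (1 + 2 * s)"
    by (simp add: power2_eq_square algebra_simps)
  also have "\<dots> < 1" using s D by (smt (verit) mult_pos_pos zero_le_power2)
  finally have s'1: "2 * real N * s' < 1" .
  have s'0: "s' \<ge> 0" using s by (simp add: s'_def)
  have pair: "exp (s * (b - y)\<^sup>2) + exp (s * (b + y)\<^sup>2) \<le> 2 * exp s * exp (s' * b\<^sup>2)"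
    if "y = 1 \<or> y = -1" for b y :: real
  proof -
    have "exp (s * (b - y)\<^sup>2) + exp (s * (b + y)\<^sup>2) =
          exp (s + s * b\<^sup>2) * (exp (2 * s * b) + exp (- (2 * s * b)))"
      using that by (auto simp: distrib_left power2_eq_square algebra_simps simp flip: exp_add)
    also have "\<dots> = 2 * exp (s + s * b\<^sup>2) * cosh (2 * s * b)"
      by (simp add: cosh_field_def)
    also have "\<dots> \<le> 2 * exp (s + s * b\<^sup>2) * exp ((2 * s * b)\<^sup>2 / 2)"
      by (intro mult_left_mono cosh_le_exp_square) simp
    also have "\<dots> = 2 * exp s * exp (s' * b\<^sup>2)"
      by (simp add: s'_def power2_eq_square algebra_simps flip: exp_add)
    finally show ?thesis .
  qed
  have "(\<Sum>w\<in>cube (Suc N). exp (s * (\<Sum>i<Suc N. w i * v i)\<^sup>2)) =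
     (\<Sum>w\<in>cube N. exp (s * ((\<Sum>i<N. w i * v i) - v N)\<^sup>2) + exp (s * ((\<Sum>i<N. w i * v i) + v N)\<^sup>2))"
    unfolding sum_cube_Suc by (simp cong: sum.cong_simp)
  also have "\<dots> \<le> (\<Sum>w\<in>cube N. 2 * exp s * exp (s' * (\<Sum>i<N. w i * v i)\<^sup>2))"
    by (intro sum_mono pair Suc.prems) simp
  also have "\<dots> = 2 * exp s * (\<Sum>w\<in>cube N. exp (s' * (\<Sum>i<N. w i * v i)\<^sup>2))"
    by (simp add: sum_distrib_left)
  also have "\<dots> \<le> 2 * exp s * (2 ^ N * exp (N * s' / (1 - 2 * real N * s')))"
    by (rule mult_left_mono[OF Suc.IH[OF _ s'0 s'1]]) (simp_all add: Suc.prems(1))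
  also have "\<dots> = 2 ^ Suc N * exp (s + N * (s' / (1 - 2 * real N * s')))"
    by (simp add: exp_add)
  also have "\<dots> \<le> 2 ^ Suc N * exp (s / D + N * (s / D))"
  proof (intro mult_left_mono, simp only: exp_le_cancel_iff, intro add_mono mult_left_mono)
    show "s \<le> s / D" using s D by (simp add: D_def field_simps mult_left_le)
    \<comment> \<open>For positive \<open>s\<close> this is
      \<open>1 / s' - 2 * N \<ge> 1 / s - 2 * (N + 1)\<close> cleared of denominators; the cubic
      term is the slack.\<close>
    have "s' * D = s * (1 - 2 * real N * s') - 4 * s ^ 3"
      by (simp add: s'_def D_def power3_eq_cube algebra_simps)
    also have "\<dots> \<le> s * (1 - 2 * real N * s')" using s by simp
    finally show "s' / (1 - 2 * real N * s') \<le> s / D"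
      using D s'1 by (simp add: field_simps)
  qed simp_all
  also have "s / D + N * (s / D) = real (Suc N) * s / (1 - 2 * real (Suc N) * s)"
    by (simp add: D_def add_divide_distrib[symmetric] algebra_simps)
  finally show ?case .
qed

definition avg :: "'a set \<Rightarrow> ('a \<Rightarrow> real) \<Rightarrow> real" where
  "avg A f = (\<Sum>a\<in>A. f a) / card A"

lemma avg_cong: "(\<And>a. a \<in> A \<Longrightarrow> f a = g a) \<Longrightarrow> avg A f = avg A g"
  by (simp add: avg_def)

text \<open>Independence of coordinates: those outside \<open>L\<close> are padded with the constant
  factor 1, which averages to 1.\<close>

lemma avg_PiE:
  assumes "finite J" "L \<subseteq> J" "finite \<Theta>" "\<Theta> \<noteq> {}"
  shows "avg (PiE J (\<lambda>_. \<Theta>)) (\<lambda>\<omega>. \<Prod>l\<in>L. f l (\<omega> l)) = (\<Prod>l\<in>L. avg \<Theta> (f l))"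
proof -
  let ?f = "\<lambda>l y. if l \<in> L then f l y else 1"
  have restr: "(\<Prod>l\<in>J. if l \<in> L then h l else 1) = (\<Prod>l\<in>L. h l)" for h :: "_ \<Rightarrow> real"
    using assms by (subst prod.inter_restrict[symmetric]) (simp_all add: Int_absorb1)
  have "(\<Sum>\<omega>\<in>PiE J (\<lambda>_. \<Theta>). \<Prod>l\<in>L. f l (\<omega> l)) = (\<Sum>\<omega>\<in>PiE J (\<lambda>_. \<Theta>). \<Prod>l\<in>J. ?f l (\<omega> l))"
    by (simp only: restr)
  also have "\<dots> = (\<Prod>l\<in>J. \<Sum>y\<in>\<Theta>. ?f l y)"
    using assms by (subst prod_sum_PiE) auto
  finally have "avg (PiE J (\<lambda>_. \<Theta>)) (\<lambda>\<omega>. \<Prod>l\<in>L. f l (\<omega> l)) = (\<Prod>l\<in>J. avg \<Theta> (?f l))"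
    using assms by (simp add: avg_def prod_dividef card_PiE)
  also have "\<dots> = (\<Prod>l\<in>J. if l \<in> L then avg \<Theta> (f l) else 1)"
    using assms by (intro prod.cong refl) (auto simp: avg_def)
  finally show ?thesis by (simp only: restr)
qed

text \<open>Symmetrizing cancels the terms linear in \<open>\<rho>\<close>: the half-sum is at most
  the cosh of the sum of the \<open>\<rho> l\<close>, so only a quadratic excess over 1
  remains.\<close>

lemma symmetrized_prod_le:
  fixes \<rho> :: "nat \<Rightarrow> real"
  assumes "\<And>l. l < k \<Longrightarrow> \<bar>\<rho> l\<bar> \<le> 1"
  shows "((\<Prod>l<k. 1 + \<rho> l) + (\<Prod>l<k. 1 - \<rho> l)) / 2 - 1 \<le> k * exp ((real k)\<^sup>2 / 2) / 2 * (\<Sum>l<k. (\<rho> l)\<^sup>2)"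
proof -
  define s where "s = k * (\<Sum>l<k. (\<rho> l)\<^sup>2) / 2"
  have prod_le: "(\<Prod>l<k. 1 + a * \<rho> l) \<le> exp (a * (\<Sum>l<k. \<rho> l))" if "\<bar>a\<bar> = 1" for a
  proof -
    have "\<bar>a * \<rho> l\<bar> \<le> 1" if "l < k" for l
      using assms[OF that] \<open>\<bar>a\<bar> = 1\<close> by (simp add: abs_mult)
    hence "0 \<le> 1 + a * \<rho> l" if "l < k" for l
      using that by (smt (verit))
    hence "(\<Prod>l<k. 1 + a * \<rho> l) \<le> (\<Prod>l<k. exp (a * \<rho> l))"
      by (intro prod_mono conjI exp_ge_add_one_self) simp
    thus ?thesis by (simp add: exp_sum sum_distrib_left)
  qed
  have "((\<Prod>l<k. 1 + \<rho> l) + (\<Prod>l<k. 1 - \<rho> l)) / 2 \<le> cosh (\<Sum>l<k. \<rho> l)"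
    using prod_le[of 1] prod_le[of "-1"] by (simp add: cosh_field_def)
  also have "\<dots> \<le> exp ((\<Sum>l<k. \<rho> l)\<^sup>2 / 2)" by (rule cosh_le_exp_square)
  also have "\<dots> \<le> exp s"
    using Cauchy_Schwarz_ineq_sum[of "\<lambda>_. 1" \<rho> "{..<k}"] by (simp add: s_def)
  finally have "((\<Prod>l<k. 1 + \<rho> l) + (\<Prod>l<k. 1 - \<rho> l)) / 2 - 1 \<le> exp s - 1" by simp
  also have "exp s - 1 \<le> s * exp s"
  proof -
    have "exp s * (1 - s) \<le> exp s * exp (- s)"
      using exp_ge_add_one_self[of "- s"] by (intro mult_left_mono) auto
    thus ?thesis by (simp add: algebra_simps flip: exp_add)
  qed
  \<comment> \<open>Since each \<open>\<rho> l\<close> is at most 1 in absolute value,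
    \<open>s\<close> is at most half the square of \<open>k\<close>; only the exponential factor is
    bounded this crudely.\<close>
  also have "\<dots> \<le> s * exp ((real k)\<^sup>2 / 2)"
  proof -
    have "(\<Sum>l<k. (\<rho> l)\<^sup>2) \<le> (\<Sum>l<k. 1)"
      using assms by (intro sum_mono) (simp add: abs_square_le_1)
    hence "real k * (\<Sum>l<k. (\<rho> l)\<^sup>2) \<le> real k * real k" by (intro mult_left_mono) simp_all
    moreover have "s \<ge> 0" by (simp add: s_def sum_nonneg)
    ultimately show ?thesis by (intro mult_left_mono) (simp_all add: s_def power2_eq_square)
  qed
  finally show ?thesis by (simp add: s_def mult_ac)
qed

section \<open>Blocks of Hadamard rows\<close>

text \<open>Coordinate \<open>j\<close> is entry \<open>j mod 2 ^ t\<close> of block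
  \<open>j div 2 ^ t\<close>. By \<open>fits\<close> the first \<open>k\<close> blocks are complete;
  only these will carry spikes.\<close>

locale hadamard_blocks =
  fixes n t k :: nat
  assumes k: "k \<ge> 1" and fits: "k * 2 ^ t \<le> n"
begin

abbreviation N :: nat where "N \<equiv> 2 ^ t"

definition rows :: "(nat \<times> real) set" where
  "rows = {..<N} \<times> {-1, 1}"

definition row :: "nat \<times> real \<Rightarrow> nat \<Rightarrow> real" where
  "row \<theta> a = snd \<theta> * hadamard t (fst \<theta>) a"

text \<open>Every block index \<open>j div N\<close> is below \<open>n\<close>, so the coordinates
  beyond the first \<open>k\<close> blocks are randomised in the same way.\<close>

definition seeds :: "(nat \<Rightarrow> nat \<times> real) set" where
  "seeds = PiE {..<n} (\<lambda>_. rows)"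

definition point :: "(nat \<Rightarrow> nat \<times> real) \<Rightarrow> nat \<Rightarrow> real" where
  "point \<omega> = (\<lambda>j\<in>{..<n}. row (\<omega> (j div N)) (j mod N))"

text \<open>Written as an image measure, so that means under it are averages over independent blocks.\<close>

definition base :: "(nat \<Rightarrow> real) \<Rightarrow> real" where
  "base x = 2 ^ n * card {\<omega>\<in>seeds. point \<omega> = x} / card seeds"

definition dir :: "(nat \<Rightarrow> real) \<Rightarrow> nat \<Rightarrow> real" where
  "dir w a = (\<Sum>i<N. w i * hadamard t i a) / N"

definition form :: "(nat \<Rightarrow> real) \<Rightarrow> nat \<Rightarrow> (nat \<Rightarrow> real) \<Rightarrow> real" where
  "form w l x = (\<Sum>a<N. dir w a * x (l * N + a))"

text \<open>On the support of \<open>base\<close> the forms of sign vectors are signs. For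
  \<open>a\<close> equal to 1 or -1 this is then \<open>2 ^ k\<close> times the indicator that all
  \<open>k\<close> forms equal \<open>a\<close>: the likelihood ratio of conditioning on that
  event.\<close>

definition tilt :: "real \<Rightarrow> (nat \<Rightarrow> nat \<Rightarrow> real) \<Rightarrow> (nat \<Rightarrow> real) \<Rightarrow> real" where
  "tilt a w x = (\<Prod>l<k. 1 + a * form (w l) l x)"

text \<open>The average of the two tilts is the likelihood ratio of conditioning on agreement of all
  signs. Using both signs removes the terms of odd order in the correlations.\<close>

definition ratio :: "real \<Rightarrow> (nat \<Rightarrow> nat \<Rightarrow> real) \<Rightarrow> (nat \<Rightarrow> real) \<Rightarrow> real" where
  "ratio \<gamma> w x = 1 - \<gamma> + \<gamma> * ((tilt 1 w x + tilt (-1) w x) / 2)"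

text \<open>By orthogonality of the rows, this is the inner product of \<open>dir w\<close> and
  \<open>dir v\<close>.\<close>

definition corr :: "(nat \<Rightarrow> real) \<Rightarrow> (nat \<Rightarrow> real) \<Rightarrow> real" where
  "corr w v = (\<Sum>i<N. w i * v i) / N"

section \<open>The null density and its pairwise uniformity\<close>

lemma rows_finite: "finite rows" "rows \<noteq> {}" and card_rows: "card rows = 2 * N"
  by (auto simp: rows_def card_cartesian_product lessThan_empty_iff)

lemma seeds_finite: "finite seeds" "seeds \<noteq> {}"
  using rows_finite by (auto simp: seeds_def finite_PiE PiE_eq_empty_iff)

lemma card_seeds_pos: "card seeds > 0"
  using seeds_finite by (simp add: card_gt_0_iff)

lemma avg_rows: "avg rows f = (\<Sum>i<N. f (i, -1) + f (i, 1)) / (2 * N)"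
proof -
  have "(\<Sum>\<theta>\<in>rows. f \<theta>) = (\<Sum>i<N. \<Sum>\<epsilon>\<in>{-1, 1}. f (i, \<epsilon>))"
    unfolding rows_def by (simp only: sum.cartesian_product case_prod_eta)
  thus ?thesis by (simp add: avg_def card_rows)
qed

lemma avg_row: "avg rows (\<lambda>\<theta>. row \<theta> a) = 0"
  by (simp add: avg_rows row_def)

text \<open>The Hadamard matrix is symmetric, so its columns are orthogonal like its rows.\<close>

lemma avg_row_row:
  assumes "a < N" "b < N" "a \<noteq> b"
  shows "avg rows (\<lambda>\<theta>. row \<theta> a * row \<theta> b) = 0"
proof -
  have "(\<Sum>i<N. hadamard t i a * hadamard t i b) = 0"
    using hadamard_orthogonal[OF assms(1,2)] assms(3) by (simp add: hadamard_commute[of t a] hadamard_commute[of t b])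
  thus ?thesis by (simp add: avg_rows row_def sum_distrib_left[symmetric])
qed

lemma avg_seeds:
  "L \<subseteq> {..<n} \<Longrightarrow> avg seeds (\<lambda>\<omega>. \<Prod>l\<in>L. f l (\<omega> l)) = (\<Prod>l\<in>L. avg rows (f l))"
  unfolding seeds_def by (rule avg_PiE) (use rows_finite in auto)

lemma point_in_cube: "\<omega> \<in> seeds \<Longrightarrow> point \<omega> \<in> cube n"
proof -
  assume \<omega>: "\<omega> \<in> seeds"
  have "row (\<omega> (j div N)) (j mod N) \<in> {-1, 1}" if "j < n" for j
  proof -
    have "j div N < n" using that by (meson div_le_dividend le_less_trans)
    hence "\<omega> (j div N) \<in> rows" using \<omega> by (auto simp: seeds_def)
    thus ?thesis using hadamard_sign[of t "fst (\<omega> (j div N))" "j mod N"]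
      by (auto simp: row_def rows_def)
  qed
  thus ?thesis by (auto simp: point_def cube_def)
qed

lemma mean_base: "cube_mean n (\<lambda>x. base x * g x) = avg seeds (\<lambda>\<omega>. g (point \<omega>))"
proof -
  have "(\<Sum>\<omega>\<in>seeds. g (point \<omega>)) = (\<Sum>x\<in>cube n. \<Sum>\<omega>\<in>{\<omega>\<in>seeds. point \<omega> = x}. g (point \<omega>))"
    by (rule sum.group[symmetric]) (use seeds_finite finite_cube point_in_cube in auto)
  also have "\<dots> = (\<Sum>x\<in>cube n. card {\<omega>\<in>seeds. point \<omega> = x} * g x)"
    by (intro sum.cong refl) simp
  finally show ?thesis
    unfolding cube_mean_def avg_def base_def
    by (simp add: sum_divide_distrib)
qed

lemma avg_const: "avg seeds (\<lambda>_. c) = c"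
  using card_seeds_pos by (simp add: avg_def)

lemma base_nonneg: "base x \<ge> 0"
  by (simp add: base_def)

lemma base_support: "base x \<noteq> 0 \<Longrightarrow> \<exists>\<omega>\<in>seeds. x = point \<omega>"
  by (auto simp: base_def card_eq_0_iff)

lemma density_base: "density_on_cube n base"
  using mean_base[of "\<lambda>_. 1"] base_nonneg by (simp add: density_on_cube_def avg_const)

lemma block_less: "j < n \<Longrightarrow> j div N < n"
  by (meson div_le_dividend le_less_trans)

text \<open>The random sign of a row gives mean zero. Two coordinates of one block are uncorrelated
  by orthogonality of columns, two of different blocks by independence.\<close>

lemma pairwise_uniform_base: "pairwise_uniform n base"
  unfolding pairwise_uniform_iff mean_base
proof (intro conjI allI impI)
  fix i assume "i < n"
  thus "avg seeds (\<lambda>\<omega>. point \<omega> i) = 0"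
    using avg_seeds[of "{i div N}" "\<lambda>_ \<theta>. row \<theta> (i mod N)"] block_less[of i]
    by (simp add: point_def avg_row)
next
  fix i j assume ij: "i < n" "j < n" "i \<noteq> j"
  note l = block_less[OF ij(1)] block_less[OF ij(2)]
  show "avg seeds (\<lambda>\<omega>. point \<omega> i * point \<omega> j) = 0"
  proof (cases "i div N = j div N")
    case True
    with ij(3) have "i mod N \<noteq> j mod N" by (metis div_mult_mod_eq)
    thus ?thesis
      using avg_seeds[of "{i div N}" "\<lambda>_ \<theta>. row \<theta> (i mod N) * row \<theta> (j mod N)"] ij l True
      by (simp add: point_def avg_row_row)
  next
    case False
    thus ?thesis
      using avg_seeds[of "{i div N, j div N}" "\<lambda>m \<theta>. row \<theta> ((if m = i div N then i else j) mod N)"] ij l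
      by (simp add: point_def avg_row)
  qed
qed

section \<open>Linear forms on the blocks\<close>

lemma coordinate_less:
  assumes "l < k" "a < N"
  shows "l * N + a < k * N"
proof -
  have "l * N + a < Suc l * N" using assms by simp
  also have "\<dots> \<le> k * N" using assms by (intro mult_le_mono1) simp
  finally show ?thesis .
qed

lemma coordinate_less_n: "l < k \<Longrightarrow> a < N \<Longrightarrow> l * N + a < n"
  using coordinate_less fits by (meson less_le_trans)

lemma block_index_less: "l < k \<Longrightarrow> l < n"
  using coordinate_less_n[of l 0] by (auto intro: le_less_trans[of _ "l * N"])

lemma sum_coordinates:
  "(\<Sum>j<n. if j < k * N then F (j div N) (j mod N) else 0) = (\<Sum>l<k. \<Sum>a<N. F l a)"
  for F :: "nat \<Rightarrow> nat \<Rightarrow> real"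
proof -
  have "(\<Sum>j<n. if j < k * N then F (j div N) (j mod N) else 0) =
        (\<Sum>j<k * N. F (j div N) (j mod N))"
    using fits by (simp add: sum.If_cases) (intro sum.cong, auto)
  also have "\<dots> = (\<Sum>l<k. \<Sum>j\<in>{l * N..<l * N + N}. F (j div N) (j mod N))"
    by (rule sum.nat_group[symmetric])
  also have "\<dots> = (\<Sum>l<k. \<Sum>a<N. F l a)"
  proof (rule sum.cong[OF refl])
    fix l
    have "(\<Sum>j\<in>{l * N..<l * N + N}. F (j div N) (j mod N)) =
          (\<Sum>a\<in>{0..<N}. F ((a + l * N) div N) ((a + l * N) mod N))"
      using sum.shift_bounds_nat_ivl[of "\<lambda>j. F (j div N) (j mod N)" 0 "l * N" N]
      by (simp add: add.commute)
    thus "(\<Sum>j\<in>{l * N..<l * N + N}. F (j div N) (j mod N)) = (\<Sum>a<N. F l a)"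
      by (simp add: atLeast0LessThan)
  qed
  finally show ?thesis .
qed

text \<open>Inversion of the Hadamard transform: the rows are orthogonal with squared length
  \<open>N\<close>.\<close>

lemma sum_dir_hadamard:
  assumes "i < N"
  shows "(\<Sum>a<N. dir w a * hadamard t i a) = w i"
proof -
  have "(\<Sum>a<N. dir w a * hadamard t i a) =
        (\<Sum>a<N. \<Sum>i'<N. w i' * (hadamard t i' a * hadamard t i a)) / N"
    by (simp add: dir_def sum_distrib_left sum_distrib_right sum_divide_distrib mult_ac)
  also have "\<dots> = (\<Sum>i'<N. w i' * (\<Sum>a<N. hadamard t i' a * hadamard t i a)) / N"
    by (subst sum.swap) (simp add: sum_distrib_left)
  also have "\<dots> = (\<Sum>i'<N. if i' = i then w i' * N else 0) / N"
    using assms by (intro arg_cong2[where f = "(/)"] sum.cong refl) (simp add: hadamard_orthogonal)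
  finally show ?thesis using assms by simp
qed

lemma sum_dir_square:
  assumes "w \<in> cube N"
  shows "(\<Sum>a<N. (dir w a)\<^sup>2) = 1"
proof -
  \<comment> \<open>Only one of the two factors is expanded; the other is then paired with a row and
    recovered by inversion.\<close>
  have "(\<Sum>a<N. (dir w a)\<^sup>2) = (\<Sum>a<N. \<Sum>i<N. w i * (dir w a * hadamard t i a)) / N"
    by (simp add: power2_eq_square dir_def[of w] sum_distrib_left sum_distrib_right sum_divide_distrib mult_ac)
  also have "\<dots> = (\<Sum>i<N. w i * (\<Sum>a<N. dir w a * hadamard t i a)) / N"
    by (subst sum.swap) (simp add: sum_distrib_left)
  also have "\<dots> = (\<Sum>i<N. 1) / N"
    using assms by (intro arg_cong2[where f = "(/)"] sum.cong refl) (simp add: sum_dir_hadamard)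
  finally show ?thesis by simp
qed

lemma form_point:
  assumes "\<omega> \<in> seeds" "l < k"
  shows "form w l (point \<omega>) = snd (\<omega> l) * w (fst (\<omega> l))"
proof -
  have "\<omega> l \<in> rows" using assms block_index_less by (auto simp: seeds_def)
  hence "fst (\<omega> l) < N" by (auto simp: rows_def)
  have "form w l (point \<omega>) = (\<Sum>a<N. dir w a * row (\<omega> l) a)"
    unfolding form_def point_def
    using coordinate_less_n[OF assms(2)] by (intro sum.cong refl) simp
  also have "\<dots> = snd (\<omega> l) * (\<Sum>a<N. dir w a * hadamard t (fst (\<omega> l)) a)"
    by (simp add: row_def sum_distrib_left mult_ac)
  finally show ?thesis using \<open>fst (\<omega> l) < N\<close> by (simp add: sum_dir_hadamard)
qed

lemma form_sign:
  assumes "\<omega> \<in> seeds" "l < k" "w \<in> cube N"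
  shows "form w l (point \<omega>) = 1 \<or> form w l (point \<omega>) = -1"
proof -
  have "\<omega> l \<in> rows" using assms block_index_less by (auto simp: seeds_def)
  thus ?thesis
    using cubeD[OF assms(3), of "fst (\<omega> l)"] by (auto simp: form_point[OF assms(1,2)] rows_def)
qed

section \<open>Likelihood ratios of the spiked densities\<close>

definition spikes :: "(nat \<Rightarrow> nat \<Rightarrow> real) set" where
  "spikes = PiE {..<k} (\<lambda>_. cube N)"

lemma spikesD: "w \<in> spikes \<Longrightarrow> l < k \<Longrightarrow> w l \<in> cube N"
  by (auto simp: spikes_def)

text \<open>Blocks are independent and the forms of block \<open>l\<close> depend on the seed of
  block \<open>l\<close> alone. Two spikes occur so that the second moment of the tilts is covered
  too.\<close>

lemma avg_seeds_form:
  "avg seeds (\<lambda>\<omega>. \<Prod>l<k. f l (form (w l) l (point \<omega>)) (form (v l) l (point \<omega>))) =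
   (\<Prod>l<k. avg rows (\<lambda>\<theta>. f l (snd \<theta> * w l (fst \<theta>)) (snd \<theta> * v l (fst \<theta>))))"
proof -
  have sub: "{..<k} \<subseteq> {..<n}" using block_index_less by (intro subsetI) simp
  have "avg seeds (\<lambda>\<omega>. \<Prod>l<k. f l (form (w l) l (point \<omega>)) (form (v l) l (point \<omega>))) =
        avg seeds (\<lambda>\<omega>. \<Prod>l<k. (\<lambda>\<theta>. f l (snd \<theta> * w l (fst \<theta>)) (snd \<theta> * v l (fst \<theta>))) (\<omega> l))"
    by (intro avg_cong prod.cong refl) (simp add: form_point)
  also have "\<dots> = (\<Prod>l<k. avg rows (\<lambda>\<theta>. f l (snd \<theta> * w l (fst \<theta>)) (snd \<theta> * v l (fst \<theta>))))"
    by (rule avg_seeds[OF sub])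
  finally show ?thesis .
qed

lemma mean_tilt: "cube_mean n (\<lambda>x. base x * tilt a w x) = 1"
proof -
  have "avg rows (\<lambda>\<theta>. 1 + a * (snd \<theta> * w l (fst \<theta>))) = 1" for l
    by (simp add: avg_rows)
  thus ?thesis
    unfolding mean_base tilt_def
    using avg_seeds_form[of "\<lambda>_ y _. 1 + a * y" w w] by simp
qed

text \<open>In each block the random sign kills the two linear terms; in the cross term it squares
  to 1 and leaves the correlation.\<close>

lemma mean_tilt_tilt:
  "cube_mean n (\<lambda>x. base x * (tilt a w x * tilt b v x)) = (\<Prod>l<k. 1 + a * b * corr (w l) (v l))"
proof -
  have "avg rows (\<lambda>\<theta>. (1 + a * (snd \<theta> * w l (fst \<theta>))) * (1 + b * (snd \<theta> * v l (fst \<theta>)))) =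
        1 + a * b * corr (w l) (v l)" for l
  proof -
    have "(\<Sum>i<N. (1 + a * (- w l i)) * (1 + b * (- v l i)) + (1 + a * w l i) * (1 + b * v l i)) =
          (\<Sum>i<N. 2 + 2 * (a * b) * (w l i * v l i))"
      by (rule sum.cong) (auto simp: algebra_simps)
    also have "\<dots> = 2 * N + 2 * (a * b) * (\<Sum>i<N. w l i * v l i)"
      by (simp add: sum.distrib sum_distrib_left)
    finally show ?thesis by (simp add: avg_rows corr_def add_divide_distrib)
  qed
  thus ?thesis
    unfolding mean_base tilt_def prod.distrib[symmetric]
    using avg_seeds_form[of "\<lambda>_ y z. (1 + a * y) * (1 + b * z)" w v] by simp
qed

lemma tilt_point_nonneg:
  assumes "\<omega> \<in> seeds" "w \<in> spikes" "\<bar>a\<bar> \<le> 1"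
  shows "tilt a w (point \<omega>) \<ge> 0"
  unfolding tilt_def
proof (rule prod_nonneg)
  fix l assume "l \<in> {..<k}"
  thus "0 \<le> 1 + a * form (w l) l (point \<omega>)"
    using form_sign[OF assms(1) _ spikesD[OF assms(2)], of l l] assms(3) by auto
qed

lemma density_ratio:
  assumes "w \<in> spikes" "0 \<le> \<gamma>" "\<gamma> \<le> 1"
  shows "density_on_cube n (\<lambda>x. base x * ratio \<gamma> w x)"
proof -
  have "base x * ratio \<gamma> w x \<ge> 0" for x
  proof (cases "base x = 0")
    case False
    then obtain \<omega> where "\<omega> \<in> seeds" "x = point \<omega>" using base_support by blast
    hence "ratio \<gamma> w x \<ge> 0"
      using tilt_point_nonneg[OF _ assms(1)] assms unfolding ratio_def by simp
    thus ?thesis using base_nonneg by simp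
  qed simp
  moreover have "cube_mean n (\<lambda>x. base x * ratio \<gamma> w x) =
     cube_mean n (\<lambda>x. (1 - \<gamma>) * base x + (\<gamma> / 2 * (base x * tilt 1 w x) + \<gamma> / 2 * (base x * tilt (-1) w x)))"
    by (rule cube_mean_cong) (simp add: ratio_def algebra_simps)
  moreover have "\<dots> = 1"
    unfolding cube_mean_add cube_mean_cmult mean_tilt using density_base
    by (simp add: density_on_cube_def)
  ultimately show ?thesis by (simp add: density_on_cube_def)
qed

text \<open>Among the four products of tilts, equal signs give the factors \<open>1 + corr\<close>
  and opposite signs \<open>1 - corr\<close>; all other terms have known mean.\<close>

lemma mean_ratio_ratio:
  "cube_mean n (\<lambda>x. base x * ratio \<gamma> w x * ratio \<gamma> v x) =
   1 + \<gamma>\<^sup>2 * (((\<Prod>l<k. 1 + corr (w l) (v l)) + (\<Prod>l<k. 1 - corr (w l) (v l))) / 2 - 1)"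
proof -
  define \<mu> where "\<mu> = 1 - \<gamma>"
  have "cube_mean n (\<lambda>x. base x * ratio \<gamma> w x * ratio \<gamma> v x) =
    cube_mean n (\<lambda>x. \<mu>\<^sup>2 * base x + \<mu> * \<gamma> / 2 * (base x * tilt 1 w x) +
      \<mu> * \<gamma> / 2 * (base x * tilt (-1) w x) + \<mu> * \<gamma> / 2 * (base x * tilt 1 v x) +
      \<mu> * \<gamma> / 2 * (base x * tilt (-1) v x) +
      \<gamma>\<^sup>2 / 4 * (base x * (tilt 1 w x * tilt 1 v x)) + \<gamma>\<^sup>2 / 4 * (base x * (tilt 1 w x * tilt (-1) v x)) +
      \<gamma>\<^sup>2 / 4 * (base x * (tilt (-1) w x * tilt 1 v x)) + \<gamma>\<^sup>2 / 4 * (base x * (tilt (-1) w x * tilt (-1) v x)))"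
    by (rule cube_mean_cong) (simp add: ratio_def \<mu>_def[symmetric] power2_eq_square field_simps)
  also have "\<dots> = \<mu>\<^sup>2 + 2 * \<mu> * \<gamma> +
      \<gamma>\<^sup>2 / 2 * ((\<Prod>l<k. 1 + corr (w l) (v l)) + (\<Prod>l<k. 1 - corr (w l) (v l)))"
    unfolding cube_mean_add cube_mean_cmult mean_tilt mean_tilt_tilt using density_base
    by (simp add: density_on_cube_def field_simps)
  also have "\<dots> = 1 + \<gamma>\<^sup>2 * (((\<Prod>l<k. 1 + corr (w l) (v l)) + (\<Prod>l<k. 1 - corr (w l) (v l))) / 2 - 1)"
    by (simp add: \<mu>_def power2_eq_square field_simps)
  finally show ?thesis .
qed

lemma abs_corr_le:
  assumes "w \<in> cube N" "v \<in> cube N"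
  shows "\<bar>corr w v\<bar> \<le> 1"
proof -
  have "\<bar>\<Sum>i<N. w i * v i\<bar> \<le> (\<Sum>i<N. \<bar>w i * v i\<bar>)" by (rule sum_abs)
  also have "\<dots> = (\<Sum>i<N. 1)"
    using cubeD[OF assms(1)] cubeD[OF assms(2)] by (intro sum.cong refl) fastforce
  finally show ?thesis by (simp add: corr_def)
qed

text \<open>The test form is the mean of the \<open>k\<close> block forms, whose coefficient vector
  has squared length \<open>1 / k\<close>. Its square is at most 1 on the support of
  \<open>base\<close> and equals 1 where all signs agree, so the excess is
  \<open>\<gamma> * (1 - 1 / k)\<close>.\<close>

lemma far_ratio:
  assumes w: "w \<in> spikes" and \<gamma>: "0 \<le> \<gamma>" "\<gamma> \<le> 1" and \<delta>: "\<delta> < \<gamma> * (1 - 1 / k)"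
  shows "far_from_pairwise_uniform n \<delta> (\<lambda>x. base x * ratio \<gamma> w x)"
proof -
  define c where "c j = (if j < k * N then dir (w (j div N)) (j mod N) / k else 0)" for j
  define q where "q x = (0 + (\<Sum>j<n. c j * x j))\<^sup>2" for x
  have lin: "(\<Sum>j<n. c j * x j) = (\<Sum>l<k. form (w l) l x) / k" for x
  proof -
    have "(\<Sum>j<n. c j * x j) =
      (\<Sum>j<n. if j < k * N then dir (w (j div N)) (j mod N) * x (j div N * N + j mod N) / k else 0)"
      by (intro sum.cong refl) (simp add: c_def div_mult_mod_eq)
    thus ?thesis
      using sum_coordinates[of "\<lambda>l a. dir (w l) a * x (l * N + a) / k"]
      by (simp add: form_def sum_divide_distrib)
  qed
  have q: "q x = ((\<Sum>l<k. form (w l) l x) / k)\<^sup>2" for x by (simp add: q_def lin)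
  have "(\<Sum>j<n. (c j)\<^sup>2) = (\<Sum>j<n. if j < k * N then (dir (w (j div N)) (j mod N) / k)\<^sup>2 else 0)"
    by (intro sum.cong refl) (simp add: c_def)
  also have "\<dots> = (\<Sum>l<k. \<Sum>a<N. (dir (w l) a / k)\<^sup>2)"
    by (rule sum_coordinates)
  also have "\<dots> = (\<Sum>l<k. 1 / k\<^sup>2)"
    by (intro sum.cong refl)
       (simp add: power_divide sum_divide_distrib[symmetric] sum_dir_square spikesD[OF w])
  also have "\<dots> = 1 / k" using k by (simp add: power2_eq_square)
  finally have c_sq: "(\<Sum>j<n. (c j)\<^sup>2) = 1 / k" .
  have sgn: "form (w l) l (point \<omega>) = 1 \<or> form (w l) l (point \<omega>) = -1"
    if "\<omega> \<in> seeds" "l < k" for \<omega> l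
    by (rule form_sign[OF that spikesD[OF w that(2)]])
  have q_le: "q (point \<omega>) \<le> 1" if "\<omega> \<in> seeds" for \<omega>
  proof -
    have "\<bar>\<Sum>l<k. form (w l) l (point \<omega>)\<bar> \<le> (\<Sum>l<k. \<bar>form (w l) l (point \<omega>)\<bar>)"
      by (rule sum_abs)
    also have "\<dots> = (\<Sum>l<k. 1)"
      using sgn[OF that] by (intro sum.cong refl) fastforce
    finally have "\<bar>(\<Sum>l<k. form (w l) l (point \<omega>)) / k\<bar> \<le> 1" using k by simp
    thus ?thesis unfolding q by (simp add: abs_square_le_1)
  qed
  \<comment> \<open>A non-zero tilt forces every form to equal \<open>a\<close>, and then the mean
    of the forms is \<open>a\<close> with square 1.\<close>
  have tilt_q: "tilt a w (point \<omega>) * q (point \<omega>) = tilt a w (point \<omega>)"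
    if \<omega>: "\<omega> \<in> seeds" and a: "a = 1 \<or> a = -1" for a \<omega>
  proof (cases "tilt a w (point \<omega>) = 0")
    case False
    have "form (w l) l (point \<omega>) = a" if "l < k" for l
    proof -
      have "1 + a * form (w l) l (point \<omega>) \<noteq> 0"
        using False that by (auto simp: tilt_def)
      thus ?thesis using sgn[OF \<omega> that] a by auto
    qed
    hence "(\<Sum>l<k. form (w l) l (point \<omega>)) = k * a" by simp
    thus ?thesis using k a by (auto simp: q)
  qed simp
  have point: "\<exists>\<omega>\<in>seeds. x = point \<omega>" if "base x * ratio \<gamma> w x \<noteq> 0" for x
    using base_support that by auto
  have "cube_mean n (\<lambda>x. base x * ratio \<gamma> w x * q x) =
    cube_mean n (\<lambda>x. (1 - \<gamma>) * (base x * q x) +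
      (\<gamma> / 2 * (base x * tilt 1 w x) + \<gamma> / 2 * (base x * tilt (-1) w x)))"
  proof (rule cube_mean_cong)
    fix x
    show "base x * ratio \<gamma> w x * q x = (1 - \<gamma>) * (base x * q x) +
      (\<gamma> / 2 * (base x * tilt 1 w x) + \<gamma> / 2 * (base x * tilt (-1) w x))"
    proof (cases "base x = 0")
      case False
      then obtain \<omega> where \<omega>: "\<omega> \<in> seeds" "x = point \<omega>" using base_support by blast
      have "base x * ratio \<gamma> w x * q x = (1 - \<gamma>) * (base x * q x) +
         (\<gamma> / 2 * (base x * (tilt 1 w x * q x)) + \<gamma> / 2 * (base x * (tilt (-1) w x * q x)))"
        by (simp add: ratio_def field_simps)
      thus ?thesis using tilt_q[OF \<omega>(1)] \<omega>(2) by simp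
    qed simp
  qed
  also have "\<dots> = (1 - \<gamma>) / k + \<gamma>"
    unfolding cube_mean_add cube_mean_cmult mean_tilt q_def
      mean_affine_square[OF density_base pairwise_uniform_base] c_sq by simp
  also have "\<dots> > \<delta> + (0\<^sup>2 + (\<Sum>j<n. (c j)\<^sup>2))"
    using \<delta> unfolding c_sq by (simp add: diff_divide_distrib algebra_simps)
  finally have gap: "\<delta> + (0\<^sup>2 + (\<Sum>j<n. (c j)\<^sup>2)) < cube_mean n (\<lambda>x. base x * ratio \<gamma> w x * q x)" .
  show ?thesis
  proof (rule far_from_pairwise_uniformI[where c\<^sub>0 = 0 and c = c])
    show "density_on_cube n (\<lambda>x. base x * ratio \<gamma> w x)" by (rule density_ratio[OF w \<gamma>])
  next
    fix x assume "base x * ratio \<gamma> w x \<noteq> 0"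
    thus "(0 + (\<Sum>j<n. c j * x j))\<^sup>2 \<le> 1" using point[of x] q_le unfolding q_def by blast
  qed (use gap in \<open>simp add: q_def\<close>)
qed

section \<open>Overlaps of random spikes\<close>

lemma finite_spikes: "finite spikes" and card_spikes: "card spikes = (2 ^ N) ^ k"
  by (simp_all add: spikes_def finite_PiE finite_cube card_PiE card_cube)

text \<open>The sum factors over the blocks into exponential moments of squared sign sums, with
  \<open>w\<close> fixed and \<open>v\<close> varying.\<close>

lemma sum_exp_corr:
  fixes \<tau> :: real
  assumes w: "w \<in> spikes" and \<tau>: "0 \<le> \<tau>" "4 * \<tau> \<le> N"
  shows "(\<Sum>v\<in>spikes. exp (\<tau> * (\<Sum>l<k. (corr (w l) (v l))\<^sup>2))) \<le> card spikes * exp (2 * k * \<tau> / N)"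
proof -
  define s where "s = \<tau> / (real N)\<^sup>2"
  have s: "0 \<le> s" "4 * real N * s \<le> 1"
    using \<tau> by (auto simp: s_def power2_eq_square field_simps)
  have "(\<Sum>v\<in>spikes. exp (\<tau> * (\<Sum>l<k. (corr (w l) (v l))\<^sup>2))) =
        (\<Sum>v\<in>spikes. \<Prod>l<k. exp (s * (\<Sum>i<N. v l i * w l i)\<^sup>2))"
    by (simp add: exp_sum sum_distrib_left corr_def s_def power_divide mult.commute)
  also have "\<dots> = (\<Prod>l<k. \<Sum>y\<in>cube N. exp (s * (\<Sum>i<N. y i * w l i)\<^sup>2))"
    unfolding spikes_def by (subst prod_sum_PiE) (auto simp: finite_cube)
  also have "\<dots> \<le> (\<Prod>l<k. 2 ^ N * exp (2 * \<tau> / N))"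
  proof (intro prod_mono conjI sum_nonneg)
    fix l assume "l \<in> {..<k}"
    hence wl: "w l \<in> cube N" using spikesD[OF w] by simp
    have "(\<Sum>y\<in>cube N. exp (s * (\<Sum>i<N. y i * w l i)\<^sup>2)) \<le>
          2 ^ N * exp (real N * s / (1 - 2 * real N * s))"
      by (rule sum_cube_exp_square) (use s cubeD[OF wl] in auto)
    also have "\<dots> \<le> 2 ^ N * exp (2 * (real N * s))"
    proof -
      \<comment> \<open>From \<open>4 * \<tau> \<le> N\<close> the denominator is at least 1/2, so
        division by it costs at most a factor 2.\<close>
      have "real N * s * 1 \<le> real N * s * (2 * (1 - 2 * real N * s))"
        using s by (intro mult_left_mono) auto
      hence "real N * s / (1 - 2 * real N * s) \<le> 2 * (real N * s)"
        using s by (subst pos_divide_le_eq) (auto simp: algebra_simps)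
      thus ?thesis by simp
    qed
    also have "2 * (real N * s) = 2 * \<tau> / N"
      by (simp add: s_def power2_eq_square)
    finally show "(\<Sum>y\<in>cube N. exp (s * (\<Sum>i<N. y i * w l i)\<^sup>2)) \<le> 2 ^ N * exp (2 * \<tau> / N)" .
  qed simp
  also have "\<dots> = card spikes * exp (2 * k * \<tau> / N)"
    by (simp add: card_spikes power_mult_distrib exp_of_nat_mult[symmetric] mult_ac)
  finally show ?thesis .
qed

text \<open>\<open>\<tau>\<close> collects the sample count, the squared mixing weight and the
  constant of \<open>symmetrized_prod_le\<close>. Each cross term is at most the exponential of
  \<open>\<tau>\<close> times the squared correlations, which is then averaged over the
  spikes.\<close>

lemma tester_bound:
  fixes p \<gamma> \<delta> \<tau> :: real and m :: nat
  assumes \<gamma>: "0 \<le> \<gamma>" "\<gamma> \<le> 1" and \<delta>: "\<delta> < \<gamma> * (1 - 1 / k)"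
    and T: "pairwise_uniformity_tester p n \<delta> m T" and p: "1 / 2 < p"
  defines "\<tau> \<equiv> m * (\<gamma>\<^sup>2 * (k * exp ((real k)\<^sup>2 / 2) / 2))"
  assumes \<tau>: "4 * \<tau> \<le> N"
  shows "1 + (2 * p - 1)\<^sup>2 \<le> exp (2 * k * \<tau> / N)"
proof -
  define K where "K = k * exp ((real k)\<^sup>2 / 2) / 2"
  have overlap: "cube_mean n (\<lambda>x. base x * ratio \<gamma> w x * ratio \<gamma> v x) ^ m \<le>
      exp (\<tau> * (\<Sum>l<k. (corr (w l) (v l))\<^sup>2))" if "w \<in> spikes" "v \<in> spikes" for w v
  proof -
    define G where "G = ((\<Prod>l<k. 1 + corr (w l) (v l)) + (\<Prod>l<k. 1 - corr (w l) (v l))) / 2"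
    have corr: "\<bar>corr (w l) (v l)\<bar> \<le> 1" if "l < k" for l
      using \<open>w \<in> spikes\<close> \<open>v \<in> spikes\<close> that by (intro abs_corr_le spikesD)
    have "0 \<le> 1 + corr (w l) (v l)" "0 \<le> 1 - corr (w l) (v l)" if "l < k" for l
      using corr[OF that] by linarith+
    hence "0 \<le> (\<Prod>l<k. 1 + corr (w l) (v l)) \<and> 0 \<le> (\<Prod>l<k. 1 - corr (w l) (v l))"
      by (intro conjI prod_nonneg) (simp_all only: lessThan_iff)
    hence "G \<ge> 0" by (simp add: G_def)
    have "\<gamma>\<^sup>2 \<le> 1" using \<gamma> by (simp add: power_le_one)
    \<comment> \<open>A convex combination of 1 and \<open>G\<close>; non-negativity is what permits
      raising the bound to the power \<open>m\<close>.\<close>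
    have "0 \<le> (1 - \<gamma>\<^sup>2) + \<gamma>\<^sup>2 * G" using \<open>\<gamma>\<^sup>2 \<le> 1\<close> \<open>G \<ge> 0\<close> by simp
    hence nonneg: "0 \<le> 1 + \<gamma>\<^sup>2 * (G - 1)" by (simp add: algebra_simps)
    have "G - 1 \<le> K * (\<Sum>l<k. (corr (w l) (v l))\<^sup>2)"
      unfolding G_def K_def using corr by (rule symmetrized_prod_le)
    hence "1 + \<gamma>\<^sup>2 * (G - 1) \<le> 1 + \<gamma>\<^sup>2 * (K * (\<Sum>l<k. (corr (w l) (v l))\<^sup>2))"
      by (intro add_left_mono mult_left_mono) auto
    also have "\<dots> \<le> exp (\<gamma>\<^sup>2 * (K * (\<Sum>l<k. (corr (w l) (v l))\<^sup>2)))"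
      by (rule exp_ge_add_one_self)
    finally have "(1 + \<gamma>\<^sup>2 * (G - 1)) ^ m \<le> exp (\<gamma>\<^sup>2 * (K * (\<Sum>l<k. (corr (w l) (v l))\<^sup>2))) ^ m"
      using nonneg by (rule power_mono)
    thus ?thesis
      unfolding mean_ratio_ratio G_def[symmetric]
      by (simp add: \<tau>_def K_def exp_of_nat_mult[symmetric] mult_ac)
  qed
  have "(real (card spikes))\<^sup>2 * (1 + (2 * p - 1)\<^sup>2) \<le>
      (\<Sum>w\<in>spikes. \<Sum>v\<in>spikes. cube_mean n (\<lambda>x. base x * ratio \<gamma> w x * ratio \<gamma> v x) ^ m)"
    by (rule second_moment_method[OF density_base pairwise_uniform_base finite_spikes _ _ T p])
       (use density_ratio far_ratio \<gamma> \<delta> in auto)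
  also have "\<dots> \<le> (\<Sum>w\<in>spikes. \<Sum>v\<in>spikes. exp (\<tau> * (\<Sum>l<k. (corr (w l) (v l))\<^sup>2)))"
    by (intro sum_mono overlap)
  also have "\<dots> \<le> (\<Sum>w\<in>spikes. card spikes * exp (2 * k * \<tau> / N))"
    by (intro sum_mono sum_exp_corr \<tau>) (simp_all add: \<tau>_def)
  also have "\<dots> = (real (card spikes))\<^sup>2 * exp (2 * k * \<tau> / N)"
    by (simp add: power2_eq_square)
  finally show ?thesis by (simp add: card_spikes)
qed

end

section \<open>The sample complexity\<close>

text \<open>The existence of a far density excludes the degenerate case in which always answering
  Yes is correct without samples.\<close>

theorem theorem4:
  fixes p \<delta>\<^sub>0 :: real
  assumes "1 / 2 < p" and "\<delta>\<^sub>0 < 1"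
  shows "\<exists>c::real. c > 0 \<and>
    (\<forall>(n::nat) (\<delta>::real) (m::nat) (T :: (nat \<Rightarrow> real) list \<Rightarrow> bool pmf).
       0 < \<delta> \<and> \<delta> \<le> \<delta>\<^sub>0 \<and>
       (\<exists>\<phi>. density_on_cube n \<phi> \<and> far_from_pairwise_uniform n \<delta> \<phi>) \<and>
       pairwise_uniformity_tester p n \<delta> m T
       \<longrightarrow> real m \<ge> c * (real n / \<delta>\<^sup>2))"
proof -
  \<comment> \<open>Strictly between \<open>\<delta>\<^sub>0\<close> and 1: the mixing weight
    \<open>\<delta> / \<delta>\<^sub>1\<close> stays below 1, and a fixed \<open>k\<close> with
    \<open>1 - 1 / k > \<delta>\<^sub>1\<close> exists.\<close>
  define \<delta>\<^sub>1 where "\<delta>\<^sub>1 = (1 + max \<delta>\<^sub>0 0) / 2"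
  have \<delta>\<^sub>1: "0 < \<delta>\<^sub>1" "\<delta>\<^sub>1 < 1" "\<delta>\<^sub>0 < \<delta>\<^sub>1"
    using assms(2) by (auto simp: \<delta>\<^sub>1_def max_def)
  obtain k :: nat where "1 / (1 - \<delta>\<^sub>1) < k"
    using reals_Archimedean2 by blast
  moreover have "0 < 1 / (1 - \<delta>\<^sub>1)" using \<delta>\<^sub>1 by simp
  ultimately have "0 < real k" by linarith
  hence k: "k \<ge> 1" by simp
  have gap: "\<delta>\<^sub>1 < 1 - 1 / k"
    using \<open>1 / (1 - \<delta>\<^sub>1) < k\<close> \<open>0 < real k\<close> \<delta>\<^sub>1 by (simp add: field_simps)
  define K where "K = k * exp ((real k)\<^sup>2 / 2) / 2"
  define A where "A = ln (1 + (2 * p - 1)\<^sup>2)"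
  \<comment> \<open>The two entries match the cases \<open>4 * \<tau> > N\<close> and
    \<open>4 * \<tau> \<le> N\<close> below.\<close>
  define c\<^sub>1 where "c\<^sub>1 = min (1 / 4) (A / (2 * k))"
  \<comment> \<open>One entry for each case: \<open>n \<ge> k\<close>; \<open>n < k\<close> with
    \<open>\<delta> \<le> 1 / 4\<close>; \<open>n < k\<close> with larger
    \<open>\<delta>\<close>.\<close>
  define c where "c = min (c\<^sub>1 * \<delta>\<^sub>1\<^sup>2 / (2 * k * K)) (min (A / (16 * k)) (1 / (16 * k)))"
  have K: "K > 0" using k by (simp add: K_def)
  have A: "A > 0" using assms(1) by (simp add: A_def ln_gt_zero)
  have A_le: "A \<le> y" if "1 + (2 * p - 1)\<^sup>2 \<le> exp y" for y
    using that ln_le_cancel_iff[of "1 + (2 * p - 1)\<^sup>2" "exp y"] by (simp add: A_def add_pos_nonneg)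
  have c\<^sub>1: "c\<^sub>1 > 0" using A k by (simp add: c\<^sub>1_def)
  have c: "c > 0" using A K c\<^sub>1 \<delta>\<^sub>1 k by (simp add: c_def)
  have main: "c * (n / \<delta>\<^sup>2) \<le> m"
    if \<delta>: "0 < \<delta>" "\<delta> \<le> \<delta>\<^sub>0"
      and \<phi>: "density_on_cube n \<phi>" "far_from_pairwise_uniform n \<delta> \<phi>"
      and T: "pairwise_uniformity_tester p n \<delta> m T"
    for n m :: nat and \<delta> \<phi> T
  proof (cases "k \<le> n")
    case True
    \<comment> \<open>The largest \<open>t\<close> for which \<open>k\<close> blocks of length
      \<open>2 ^ t\<close> fit, so that \<open>2 ^ t\<close> is \<open>n\<close> up to a constant
      factor.\<close>
    hence "1 \<le> n div k" using k by (simp add: div_greater_zero_iff Suc_le_eq)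
    then obtain t where t: "2 ^ t \<le> n div k" "n div k < 2 ^ (t + 1)"
      using ex_power_ivl1[of 2 "n div k"] by auto
    have fits: "k * 2 ^ t \<le> n"
      using t(1) k by (simp add: less_eq_div_iff_mult_less_eq mult.commute)
    have "n < 2 ^ (t + 1) * k"
      using t(2) k by (simp add: div_less_iff_less_mult)
    hence "real n < real (2 ^ (t + 1) * k)" by (simp only: of_nat_less_iff)
    hence n: "real n \<le> 2 * k * 2 ^ t" by (simp add: mult_ac)
    interpret hadamard_blocks n t k by unfold_locales (fact k fits)+
    define \<gamma> where "\<gamma> = \<delta> / \<delta>\<^sub>1"
    have \<gamma>: "0 < \<gamma>" "\<gamma> \<le> 1" using \<delta> \<delta>\<^sub>1 by (auto simp: \<gamma>_def)
    have "\<delta> = \<gamma> * \<delta>\<^sub>1" using \<delta>\<^sub>1 by (simp add: \<gamma>_def)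
    also have "\<dots> < \<gamma> * (1 - 1 / k)" using \<gamma> gap by (intro mult_strict_left_mono)
    finally have far: "\<delta> < \<gamma> * (1 - 1 / k)" .
    define \<tau> where "\<tau> = m * (\<gamma>\<^sup>2 * K)"
    have "c\<^sub>1 * 2 ^ t \<le> \<tau>"
    proof (cases "4 * \<tau> \<le> N")
      case True
      have "1 + (2 * p - 1)\<^sup>2 \<le> exp (2 * k * \<tau> / N)"
        using tester_bound[OF _ \<gamma>(2) far T assms(1)] \<gamma> True by (simp add: \<tau>_def K_def)
      hence "A \<le> 2 * k * \<tau> / N" by (rule A_le)
      hence "A / (2 * k) * 2 ^ t \<le> \<tau>" using k by (simp add: field_simps)
      moreover have "c\<^sub>1 * 2 ^ t \<le> A / (2 * k) * 2 ^ t"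
        by (intro mult_right_mono) (simp_all add: c\<^sub>1_def)
      ultimately show ?thesis by linarith
    next
      case False
      hence "2 ^ t < 4 * \<tau>" by simp
      moreover have "c\<^sub>1 * 2 ^ t \<le> 1 / 4 * 2 ^ t"
        by (intro mult_right_mono) (simp_all add: c\<^sub>1_def)
      ultimately show ?thesis by linarith
    qed
    have "c * (n / \<delta>\<^sup>2) \<le> c\<^sub>1 * \<delta>\<^sub>1\<^sup>2 / (2 * k * K) * (2 * k * 2 ^ t / \<delta>\<^sup>2)"
      using c K c\<^sub>1 \<delta> n by (intro mult_mono divide_right_mono) (auto simp: c_def)
    also have "\<dots> = c\<^sub>1 * 2 ^ t / (\<gamma>\<^sup>2 * K)"
      using k \<delta> \<delta>\<^sub>1 K by (simp add: \<gamma>_def power_divide field_simps)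
    also have "\<dots> \<le> \<tau> / (\<gamma>\<^sup>2 * K)"
      using \<open>c\<^sub>1 * 2 ^ t \<le> \<tau>\<close> K by (intro divide_right_mono) simp_all
    also have "\<dots> = m" using \<gamma> K by (simp add: \<tau>_def)
    finally show ?thesis .
  next
    case False
    hence n: "real n \<le> k" by simp
    show ?thesis
    proof (cases "\<delta> \<le> 1 / 4")
      case True
      show ?thesis
      proof (cases "n = 0")
        case False
        have "A \<le> 16 * m * \<delta>\<^sup>2"
          by (rule A_le, rule biased_coordinate_bound[OF _ \<delta>(1) True T assms(1)]) (use False in simp)
        have "c * (n / \<delta>\<^sup>2) \<le> A / (16 * k) * (k / \<delta>\<^sup>2)"
          using c A n by (intro mult_mono divide_right_mono) (auto simp: c_def)
        also have "\<dots> \<le> m"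
          using \<open>A \<le> 16 * m * \<delta>\<^sup>2\<close> k \<delta> by (simp add: field_simps)
        finally show ?thesis .
      qed simp
    next
      case False
      hence "(1 / 4)\<^sup>2 \<le> \<delta>\<^sup>2" by (intro power_mono) auto
      \<comment> \<open>Both \<open>n\<close> and \<open>1 / \<delta>\<close> are bounded here, so
        the claimed bound is at most 1 and a single sample suffices for it.\<close>
      have "c * (n / \<delta>\<^sup>2) \<le> 1 / (16 * k) * (k / (1 / 4)\<^sup>2)"
        using c n \<open>(1 / 4)\<^sup>2 \<le> \<delta>\<^sup>2\<close> \<delta> by (intro mult_mono frac_le) (auto simp: c_def)
      also have "\<dots> = 1" using k by (simp add: power2_eq_square)
      also have "\<dots> \<le> m" using one_sample_needed[OF \<phi> T assms(1)] by simp
      finally show ?thesis .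
    qed
  qed
  show ?thesis using c main by blast
qed

end
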